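(* In the dynamical discrete web, $$\mathbb{P}\left(S_0^\tau \text{ is recurrent for all } \tau\ge 0\right)=1.$$
   Context: Let $\mathbb{Z}^2_{even}=\{(x,t)\in\mathbb{Z}^2: x+t \text{ is even}\}$. Dynamical discrete web: the processes $(\xi_z^\tau)_{\tau\ge 0}$, $z\in\mathbb{Z}^2_{even}$, are independent, right-continuous, $\{-1,+1\}$-valued; for each $z$, $\xi_z^0$ is uniform on $\{-1,+1\}$, and at each ring of a rate-one Poisson clock at $z$ the value is replaced by a fresh independent uniform $\{-1,+1\}$ value. For each $\tau\geq 0$, $S_0^\tau$ is the path with $S_0^\tau(0)=0$, $S_0^\tau(t+1)=S_0^\tau(t)+\xi^\tau_{(S_0^\tau(t),t)}$ for integers $t\ge 0$, linearly interpolated between integer times. A path is recurrent if it returns to its starting position $0$ at infinitely many integer times. *)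

theory Defs
  imports "HOL-Probability.Probability"
begin

definition even_lattice :: "(int \<times> int) set" where
  "even_lattice = {(x, t). even (x + t)}"

(* The time of the n-th ring of a clock with waiting times gap 0, gap 1, ...;
   by convention the 0-th ring is at dynamical time 0. *)
definition ring_time :: "(nat \<Rightarrow> 'a \<Rightarrow> real) \<Rightarrow> nat \<Rightarrow> 'a \<Rightarrow> real" where
  "ring_time gap n \<omega> = (\<Sum>k<n. gap k \<omega>)"

(* A rate-one Poisson clock is given by its independent Exp(1) waiting times. At the site z,
   mark z 0 is the initial value and mark z n (n > 0) the fresh value drawn at the n-th ring.
   All waiting times and marks, over all sites, are jointly independent; in particular so are
   the processes \<xi> z for distinct z. The resampling clause determines \<xi> z almost surely,
   since almost surely the ring times increase to infinity. *)
locale dynamical_discrete_web = prob_space M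
  for M :: "'a measure" +
  fixes gap :: "int \<times> int \<Rightarrow> nat \<Rightarrow> 'a \<Rightarrow> real"
    and mark :: "int \<times> int \<Rightarrow> nat \<Rightarrow> 'a \<Rightarrow> int"
    and \<xi> :: "int \<times> int \<Rightarrow> real \<Rightarrow> 'a \<Rightarrow> int"
  assumes gap_exponential:
      "\<And>z n. z \<in> even_lattice \<Longrightarrow>
        distributed M lborel (gap z n) (\<lambda>x. ennreal (exponential_density 1 x))"
    and mark_uniform:
      "\<And>z n. z \<in> even_lattice \<Longrightarrow> random_variable (count_space UNIV) (mark z n)"
      "\<And>z n. z \<in> even_lattice \<Longrightarrow>
        distr M (count_space UNIV) (mark z n) = measure_pmf (pmf_of_set {-1, 1})"
    and independent:
      "indep_vars (\<lambda>_. borel)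
        (case_sum (\<lambda>(z, n). gap z n) (\<lambda>(z, n) \<omega>. real_of_int (mark z n \<omega>)))
        ((even_lattice \<times> UNIV) <+> (even_lattice \<times> UNIV))"
    and sign_valued:
      "\<And>z \<tau> \<omega>. z \<in> even_lattice \<Longrightarrow> 0 \<le> \<tau> \<Longrightarrow> \<omega> \<in> space M \<Longrightarrow> \<xi> z \<tau> \<omega> \<in> {-1, 1}"
    and right_continuous:
      "\<And>z \<tau> \<omega>. z \<in> even_lattice \<Longrightarrow> 0 \<le> \<tau> \<Longrightarrow> \<omega> \<in> space M \<Longrightarrow>
        continuous (at_right \<tau>) (\<lambda>s. \<xi> z s \<omega>)"
    and resampling:
      "\<And>z. z \<in> even_lattice \<Longrightarrow>
        AE \<omega> in M. \<forall>n \<tau>. ring_time (gap z) n \<omega> \<le> \<tau> \<and> \<tau> < ring_time (gap z) (Suc n) \<omega>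
          \<longrightarrow> \<xi> z \<tau> \<omega> = mark z n \<omega>"

(* The position at integer times of the path from the origin following the arrows c. *)
primrec walk :: "(int \<times> int \<Rightarrow> int) \<Rightarrow> nat \<Rightarrow> int" where
  "walk c 0 = 0"
| "walk c (Suc t) = walk c t + c (walk c t, int t)"

(* Linear interpolation; only times t \<ge> 0 are meaningful. *)
definition web_path :: "(int \<times> int \<Rightarrow> int) \<Rightarrow> real \<Rightarrow> real" where
  "web_path c t = (1 - frac t) * real_of_int (walk c (nat \<lfloor>t\<rfloor>))
                + frac t * real_of_int (walk c (Suc (nat \<lfloor>t\<rfloor>)))"

definition recurrent_path :: "(real \<Rightarrow> real) \<Rightarrow> bool" where
  "recurrent_path p \<longleftrightarrow> infinite {n::nat. p (real n) = 0}"

end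

theory Submission
  imports Defs
begin

text \<open>
Suppose that at some dynamical time \<open>\<tau> < H\<close> the path from the origin returns to \<open>0\<close> only finitely often.
By symmetry it may be taken to stay positive from a time \<open>n0\<close> on. Divide \<open>[0, H)\<close> into \<open>H * 2^k\<close> intervals
of length \<open>2^(-k)\<close>. For each of them let a walk start from height \<open>n0\<close> at time \<open>n0\<close>, go up wherever the
arrow points up at some moment of the interval, and be absorbed at \<open>0\<close>. Since paths cannot cross, it
dominates the paths for all \<open>\<tau>\<close> in the interval (\<open>absorbed_mono\<close>). Its upward bias is at most \<open>2^(-k)\<close>
(\<open>attains_prob_le\<close>), too small to be felt before the time \<open>4^k\<close>; so it survives up to then with probability
of order \<open>n0 / 2^k\<close> (\<open>survival_le_sqrt\<close>).

The expected number of surviving intervals is thus bounded in \<open>k\<close>, but it does not tend to \<open>0\<close>, and a first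
moment bound alone is inconclusive: as \<open>k\<close> grows, the survivors behave like a critical branching
process. Such a process dies out provided that a bounded population becomes extinct with a probability
bounded below. Here a bounded population means boundedly many walks at heights of order \<open>2^k\<close>; the
heights are under control because the expected position of an absorbed walk remains bounded
(\<open>mean_at_diffusive_time\<close>). Walks of different intervals use dependent arrows, so their deaths are arranged
in successive time blocks, one walk per block (\<open>uniform_extinction\<close>). Consequently the probability
that any interval survives tends to \<open>0\<close> (\<open>some_survivor_prob_tendsto_0\<close>).

All estimates rest on the potential \<open>(1 - mu)^y\<close>, which is subharmonic for a walk of bias at most \<open>mu / 8\<close> and
yields both the upper bound on survival and the lower bound on absorption (\<open>survival_le\<close>).
\<close>

section \<open>Walks absorbed at zero\<close>

text \<open>A nearest neighbour walk from height \<open>x\<close> at time \<open>s\<close>, killed at the axis. Absorption turns the event of having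
stayed positive so far into a property of the current value, so that survival becomes a Markov statement.\<close>

primrec absorbed :: "(int \<times> int \<Rightarrow> int) \<Rightarrow> int \<Rightarrow> int \<Rightarrow> nat \<Rightarrow> int" where
  "absorbed c s x 0 = x"
| "absorbed c s x (Suc n) = absorbed c s x n +
     (if absorbed c s x n \<le> 0 then 0 else c (absorbed c s x n, s + int n))"

lemma absorbed_add:
  "absorbed c s x (m + n) = absorbed c (s + int m) (absorbed c s x m) n"
  by (induction n) (simp_all add: algebra_simps)

lemma absorbed_stays:
  assumes "absorbed c s x m \<le> 0" "m \<le> n"
  shows "absorbed c s x n = absorbed c s x m"
  using assms(2,1) by (induction n rule: dec_induct) auto

lemma absorbed_bounds:
  assumes "\<And>z. c z \<in> {-1, 1}" "0 \<le> x"
  shows "0 \<le> absorbed c s x n" "absorbed c s x n \<le> x + int n"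
proof (induction n)
  case (Suc n)
  { case 1 then show ?case using Suc assms(1)[of "(absorbed c s x n, s + int n)"] by auto }
  { case 2 then show ?case using Suc assms(1)[of "(absorbed c s x n, s + int n)"] by auto }
qed (use assms in auto)

lemma absorbed_parity:
  assumes "\<And>z. c z \<in> {-1, 1}" "even (x + s)" "\<And>m. m < n \<Longrightarrow> 0 < absorbed c s x m"
  shows "even (absorbed c s x n + (s + int n))"
  using assms(3)
proof (induction n)
  case (Suc n)
  have "0 < absorbed c s x n"
    by (rule Suc.prems) simp
  moreover have "even (absorbed c s x n + (s + int n))"
    by (rule Suc.IH) (rule Suc.prems, simp)
  ultimately show ?case
    using assms(1)[of "(absorbed c s x n, s + int n)"] by auto
qed (use assms in auto)

text \<open>Two walks of the same parity differ by an even number, so one step cannot make them cross: where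
they meet they use the same site, and where they differ the gap is at least 2. Only sites of even
parity are visited, hence only there must the arrows be comparable.\<close>

lemma absorbed_mono:
  assumes c: "\<And>z. c z \<in> {-1, 1}" and c': "\<And>z. c' z \<in> {-1, 1}"
    and le: "\<And>z. even (fst z + snd z) \<Longrightarrow> c z \<le> c' z"
    and x: "0 \<le> x" "x \<le> x'" and par: "even (x + s)" "even (x' + s)"
  shows "absorbed c s x n \<le> absorbed c' s x' n"
proof (induction n)
  case (Suc n)
  let ?y = "absorbed c s x n" and ?y' = "absorbed c' s x' n"
  have x': "0 \<le> x'" using x by simp
  have nn: "0 \<le> absorbed c' s x' (Suc n)" using absorbed_bounds(1)[OF c' x'] .
  show ?case
  proof (cases "?y \<le> 0")
    case True
    then show ?thesis using nn by auto
  next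
    case False
    have "0 < absorbed c s x m" if "m < n" for m
      using absorbed_stays[of c s x m n] False that by (cases "absorbed c s x m \<le> 0") auto
    moreover have "0 < absorbed c' s x' m" if "m < n" for m
      using absorbed_stays[of c' s x' m n] False Suc that by (cases "absorbed c' s x' m \<le> 0") auto
    ultimately have p: "even (?y + (s + int n))" "even (?y' + (s + int n))"
      by (auto intro: absorbed_parity[OF c par(1)] absorbed_parity[OF c' par(2)] simp del: even_add)
    show ?thesis
    proof (cases "?y = ?y'")
      case True
      then show ?thesis using le[of "(?y, s + int n)"] p False by auto
    next
      case ne: False
      have "?y' \<noteq> ?y + 1" using p by auto
      then have "?y + 2 \<le> ?y'" using ne Suc by linarith
      then show ?thesis
        using c[of "(?y, s + int n)"] c'[of "(?y', s + int n)"] False by auto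
    qed
  qed
qed (use x in auto)

section \<open>Walks in a field of refining arrows\<close>

text \<open>The features of the web on which the probabilistic argument rests. The index \<open>i\<close> of generation \<open>k\<close>
stands for the dynamical time interval \<open>[i/2^k, (i+1)/2^k)\<close>, and \<open>arr k i z\<close> for the largest value that
the arrow at \<open>z\<close> takes during it. Arrows before and after any time are independent, the
upward bias is at most the length of the interval, and halving the interval lowers the arrows. The
arrows at one site for different \<open>i\<close> may depend on each other in any way.\<close>

locale refining_arrows = prob_space M
  for M :: "'a measure" +
  fixes past future :: "int \<Rightarrow> 'a measure"
    and arr :: "nat \<Rightarrow> nat \<Rightarrow> int \<times> int \<Rightarrow> 'a \<Rightarrow> int"
  assumes space_past: "space (past t) = space M" and sets_past: "sets (past t) \<subseteq> sets M"
    and space_future: "space (future t) = space M" and sets_future: "sets (future t) \<subseteq> sets M"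
    and indep_past_future:
      "A \<in> sets (past t) \<Longrightarrow> B \<in> sets (future t) \<Longrightarrow> prob (A \<inter> B) = prob A * prob B"
    and arr_past: "snd z < t \<Longrightarrow> arr k i z \<in> measurable (past t) (count_space UNIV)"
    and arr_future: "t \<le> snd z \<Longrightarrow> arr k i z \<in> measurable (future t) (count_space UNIV)"
    and arr_sign: "arr k i z \<omega> \<in> {-1, 1}"
    and arr_up: "prob {\<omega> \<in> space M. arr k i z \<omega> = 1} \<le> 1/2 + 1/2^k"
    and arr_refine: "arr (Suc k) i z \<omega> \<le> arr k (i div 2) z \<omega>"
begin

definition pos :: "nat \<Rightarrow> nat \<Rightarrow> int \<Rightarrow> int \<Rightarrow> nat \<Rightarrow> 'a \<Rightarrow> int" where
  "pos k i s x n \<omega> = absorbed (\<lambda>z. arr k i z \<omega>) s x n"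

lemma pos_0 [simp]: "pos k i s x 0 \<omega> = x"
  by (simp add: pos_def)

lemma pos_Suc:
  "pos k i s x (Suc n) \<omega> = pos k i s x n \<omega> +
     (if pos k i s x n \<omega> \<le> 0 then 0 else arr k i (pos k i s x n \<omega>, s + int n) \<omega>)"
  by (simp add: pos_def)

lemmas pos_add = absorbed_add[of "\<lambda>z. arr k i z \<omega>" for k i \<omega>, folded pos_def]
lemmas pos_stays = absorbed_stays[of "\<lambda>z. arr k i z \<omega>" for k i \<omega>, folded pos_def]
lemmas pos_bounds = absorbed_bounds[of "\<lambda>z. arr k i z \<omega>" for k i \<omega>, OF arr_sign, folded pos_def]

lemma pos_measurable_aux:
  assumes "\<And>z. s \<le> snd z \<Longrightarrow> snd z < s + int n \<Longrightarrow>
             arr k i z \<in> measurable N (count_space UNIV)"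
  shows "pos k i s x n \<in> measurable N (count_space UNIV)"
  using assms
proof (induction n)
  case 0
  have "pos k i s x 0 = (\<lambda>_. x)" by auto
  then show ?case by simp
next
  case (Suc n)
  have pos: "pos k i s x n \<in> measurable N (count_space UNIV)"
    by (rule Suc.IH) (rule Suc.prems, auto)
  have "(\<lambda>y \<omega>. y + (if y \<le> 0 then 0 else arr k i (y, s + int n) \<omega>)) y \<in> measurable N (count_space UNIV)"
    for y
  proof -
    have [measurable]: "arr k i (y, s + int n) \<in> measurable N (count_space UNIV)"
      by (rule Suc.prems) auto
    show ?thesis by measurable
  qed
  from measurable_compose_countable[OF this pos] show ?case
    by (simp add: pos_Suc[abs_def])
qed

lemma pos_past: "s + int n \<le> t \<Longrightarrow> pos k i s x n \<in> measurable (past t) (count_space UNIV)"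
  by (rule pos_measurable_aux) (auto intro: arr_past)

lemma pos_future: "t \<le> s \<Longrightarrow> pos k i s x n \<in> measurable (future t) (count_space UNIV)"
  by (rule pos_measurable_aux) (auto intro: arr_future)

lemma past_M: "f \<in> measurable (past t) N \<Longrightarrow> f \<in> measurable M N"
  unfolding measurable_def space_past using sets_past[of t] by blast

lemma future_M: "f \<in> measurable (future t) N \<Longrightarrow> f \<in> measurable M N"
  unfolding measurable_def space_future using sets_future[of t] by blast

lemma pos_M [measurable]: "pos k i s x n \<in> measurable M (count_space UNIV)"
  by (rule past_M[OF pos_past[OF order_refl]])

lemma arr_M [measurable]: "arr k i z \<in> measurable M (count_space UNIV)"
  by (rule future_M[OF arr_future[OF order_refl]])

lemma pos_integrable [simp]:
  fixes f :: "int \<Rightarrow> real"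
  assumes "0 \<le> x"
  shows "integrable M (\<lambda>\<omega>. f (pos k i s x n \<omega>))"
proof (rule integrable_const_bound[where B = "\<Sum>y\<in>{0..x + int n}. \<bar>f y\<bar>"])
  show "AE \<omega> in M. norm (f (pos k i s x n \<omega>)) \<le> (\<Sum>y\<in>{0..x + int n}. \<bar>f y\<bar>)"
    using pos_bounds[OF assms] by (auto intro!: member_le_sum AE_I2)
  show "(\<lambda>\<omega>. f (pos k i s x n \<omega>)) \<in> borel_measurable M"
    by measurable
qed

text \<open>The arrow used at time \<open>s + n\<close> is independent of the position reached by then. So a pointwise
inequality between \<open>f\<close> averaged over one biased step and \<open>g\<close> integrates to one between expectations.
It is required for every admissible bias because the arrows at different sites may have different laws.\<close>

lemma step_expectation_le:
  fixes f g :: "int \<Rightarrow> real"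
  assumes x: "0 \<le> x" and zero: "f 0 \<le> g 0"
    and step: "\<And>y p. 0 < y \<Longrightarrow> 0 \<le> p \<Longrightarrow> p \<le> 1/2 + 1/2^k \<Longrightarrow>
                 p * f (y + 1) + (1 - p) * f (y - 1) \<le> g y"
  shows "expectation (\<lambda>\<omega>. f (pos k i s x (Suc n) \<omega>)) \<le> expectation (\<lambda>\<omega>. g (pos k i s x n \<omega>))"
proof -
  define R where "R = {0..x + int n}"
  have fin: "finite R" by (simp add: R_def)
  define Y where "Y y = {\<omega> \<in> space M. pos k i s x n \<omega> = y}" for y
  define U where "U y = {\<omega> \<in> space M. arr k i (y, s + int n) \<omega> = 1}" for y
  define h where "h y \<omega> = (if y \<le> 0 then f y * indicator (Y y) \<omega>
      else f (y - 1) * indicator (Y y) \<omega> + (f (y + 1) - f (y - 1)) * indicator (Y y \<inter> U y) \<omega>)" for y \<omega>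
  have [measurable]: "Y y \<in> sets M" "U y \<in> sets M" for y
    unfolding Y_def U_def by measurable
  have mem: "pos k i s x n \<omega> \<in> R" for \<omega>
    using pos_bounds[OF x] by (auto simp: R_def)
  have eq1: "f (pos k i s x (Suc n) \<omega>) = (\<Sum>y\<in>R. h y \<omega>)" if "\<omega> \<in> space M" for \<omega>
  proof -
    have "(\<Sum>y\<in>R. h y \<omega>) = (\<Sum>y\<in>{pos k i s x n \<omega>}. h y \<omega>)"
      using mem fin by (intro sum.mono_neutral_right) (auto simp: h_def Y_def)
    also have "\<dots> = f (pos k i s x (Suc n) \<omega>)"
      using arr_sign[of k i "(pos k i s x n \<omega>, s + int n)" \<omega>] that
      by (auto simp: h_def Y_def U_def pos_Suc indicator_def)
    finally show ?thesis ..
  qed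
  have eq2: "g (pos k i s x n \<omega>) = (\<Sum>y\<in>R. g y * indicator (Y y) \<omega>)" if "\<omega> \<in> space M" for \<omega>
  proof -
    have "(\<Sum>y\<in>R. g y * indicator (Y y) \<omega>) = (\<Sum>y\<in>{pos k i s x n \<omega>}. g y * indicator (Y y) \<omega>)"
      using mem fin by (intro sum.mono_neutral_right) (auto simp: Y_def)
    then show ?thesis using that by (simp add: Y_def)
  qed
  have ind: "prob (Y y \<inter> U y) = prob (Y y) * prob (U y)" for y
  proof (rule indep_past_future)
    show "Y y \<in> sets (past (s + int n))"
      using measurable_sets[OF pos_past[OF order_refl], of "{y}" k i s x n]
      by (simp add: Y_def space_past vimage_def Int_def conj_commute)
    show "U y \<in> sets (future (s + int n))"
      using measurable_sets[OF arr_future, of "s + int n" "(y, s + int n)" "{1}" k i]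
      by (simp add: U_def space_future vimage_def Int_def conj_commute)
  qed
  have inth: "integrable M (h y)" for y
    unfolding h_def by (cases "y \<le> 0") (auto intro!: integrable_add simp: less_top[symmetric])
  have hle: "expectation (h y) \<le> g y * prob (Y y)" if "y \<in> R" for y
  proof (cases "y \<le> 0")
    case True
    then have "y = 0" using that by (simp add: R_def)
    then show ?thesis using zero unfolding h_def by (simp add: mult_right_mono)
  next
    case False
    have "expectation (h y) = f (y - 1) * prob (Y y) + (f (y + 1) - f (y - 1)) * prob (Y y \<inter> U y)"
      using False unfolding h_def by (simp add: less_top[symmetric])
    also have "\<dots> = (prob (U y) * f (y + 1) + (1 - prob (U y)) * f (y - 1)) * prob (Y y)"
      by (simp add: ind algebra_simps)
    also have "\<dots> \<le> g y * prob (Y y)"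
      by (intro mult_right_mono step) (use False arr_up in \<open>auto simp: U_def\<close>)
    finally show ?thesis .
  qed
  have "expectation (\<lambda>\<omega>. f (pos k i s x (Suc n) \<omega>)) = expectation (\<lambda>\<omega>. \<Sum>y\<in>R. h y \<omega>)"
    using eq1 by (intro Bochner_Integration.integral_cong) auto
  also have "\<dots> = (\<Sum>y\<in>R. expectation (h y))"
    by (intro Bochner_Integration.integral_sum inth)
  also have "\<dots> \<le> (\<Sum>y\<in>R. g y * prob (Y y))"
    by (intro sum_mono hle)
  also have "\<dots> = expectation (\<lambda>\<omega>. \<Sum>y\<in>R. g y * indicator (Y y) \<omega>)"
    by (subst Bochner_Integration.integral_sum) (auto simp: less_top[symmetric])
  also have "\<dots> = expectation (\<lambda>\<omega>. g (pos k i s x n \<omega>))"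
    using eq2 by (intro Bochner_Integration.integral_cong) auto
  finally show ?thesis .
qed

end

section \<open>The Markov property and the survival of one walk\<close>

text \<open>The Markov property in the form in which it is used below: \<open>D y\<close> is an event about the future that
is started from the state \<open>y\<close>, while \<open>X\<close> is the state reached.\<close>

lemma (in prob_space) prob_bounded_below_independent_choice:
  fixes X :: "'a \<Rightarrow> 'b" and D :: "'b \<Rightarrow> 'a set"
  assumes fin: "finite (X ` E)" and E: "E \<in> events"
    and X: "\<And>y. y \<in> X ` E \<Longrightarrow> {\<omega> \<in> E. X \<omega> = y} \<in> events"
    and D: "\<And>y. y \<in> X ` E \<Longrightarrow> D y \<in> events"
    and ind: "\<And>y. y \<in> X ` E \<Longrightarrow>
      prob ({\<omega> \<in> E. X \<omega> = y} \<inter> D y) = prob {\<omega> \<in> E. X \<omega> = y} * prob (D y)"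
    and ge: "\<And>y. y \<in> X ` E \<Longrightarrow> c \<le> prob (D y)"
  shows "c * prob E \<le> prob {\<omega> \<in> E. \<omega> \<in> D (X \<omega>)}"
proof -
  have "prob E = prob (\<Union>y\<in>X ` E. {\<omega> \<in> E. X \<omega> = y})"
    by (rule arg_cong[where f = prob]) auto
  also have "\<dots> = (\<Sum>y\<in>X ` E. prob {\<omega> \<in> E. X \<omega> = y})"
    using X by (intro finite_measure_finite_Union fin) (auto simp: disjoint_family_on_def)
  finally have "c * prob E = (\<Sum>y\<in>X ` E. c * prob {\<omega> \<in> E. X \<omega> = y})"
    by (simp add: sum_distrib_left)
  also have "\<dots> \<le> (\<Sum>y\<in>X ` E. prob ({\<omega> \<in> E. X \<omega> = y} \<inter> D y))"
    using ge by (intro sum_mono) (simp add: ind mult.commute[of c] mult_left_mono)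
  also have "\<dots> = prob (\<Union>y\<in>X ` E. {\<omega> \<in> E. X \<omega> = y} \<inter> D y)"
    using X D by (intro finite_measure_finite_Union[symmetric] fin) (auto simp: disjoint_family_on_def)
  also have "(\<Union>y\<in>X ` E. {\<omega> \<in> E. X \<omega> = y} \<inter> D y) = {\<omega> \<in> E. \<omega> \<in> D (X \<omega>)}"
    by auto
  finally show ?thesis .
qed

lemma four_power: "(4::real) ^ k = (2 ^ k)\<^sup>2"
  by (simp add: power2_eq_square flip: power_mult_distrib)

context refining_arrows
begin

definition alive :: "nat \<Rightarrow> nat \<Rightarrow> int \<Rightarrow> int \<Rightarrow> nat \<Rightarrow> 'a set" where
  "alive k i s x n = {\<omega> \<in> space M. 0 < pos k i s x n \<omega>}"

lemma alive_M [measurable]: "alive k i s x n \<in> events"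
  unfolding alive_def by measurable

lemma alive_antimono: "m \<le> n \<Longrightarrow> alive k i s x n \<subseteq> alive k i s x m"
  unfolding alive_def using pos_stays[where m = m and n = n] by (force simp: not_less[symmetric])

lemma expectation_alive:
  "expectation (\<lambda>\<omega>. if 0 < pos k i s x n \<omega> then 1 else 0) = prob (alive k i s x n)"
proof -
  have "expectation (\<lambda>\<omega>. if 0 < pos k i s x n \<omega> then 1 else 0 :: real) = expectation (indicator (alive k i s x n))"
    by (intro Bochner_Integration.integral_cong) (auto simp: alive_def)
  then show ?thesis by simp
qed

lemma mean_step:
  assumes "0 \<le> x"
  shows "expectation (\<lambda>\<omega>. of_int (pos k i s x (Suc n) \<omega>))
     \<le> expectation (\<lambda>\<omega>. of_int (pos k i s x n \<omega>)) + 2 / 2^k * prob (alive k i s x n)"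
proof -
  let ?g = "\<lambda>y. real_of_int y + 2 / 2^k * (if 0 < y then 1 else 0)"
  have "expectation (\<lambda>\<omega>. of_int (pos k i s x (Suc n) \<omega>)) \<le> expectation (\<lambda>\<omega>. ?g (pos k i s x n \<omega>))"
  proof (rule step_expectation_le[OF assms])
    fix y :: int and p :: real
    assume "0 < y" "p \<le> 1/2 + 1/2^k"
    then show "p * of_int (y + 1) + (1 - p) * of_int (y - 1) \<le> ?g y"
      by (simp add: algebra_simps)
  qed simp
  also have "\<dots> = expectation (\<lambda>\<omega>. of_int (pos k i s x n \<omega>)) + 2 / 2^k * prob (alive k i s x n)"
    by (subst Bochner_Integration.integral_add)
       (use assms pos_integrable[OF assms, of "\<lambda>y. 2 / 2^k * (if 0 < y then 1 else 0)"] in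
         \<open>simp_all add: expectation_alive[symmetric]\<close>)
  finally show ?thesis .
qed

text \<open>The bias moves a walk only while it is alive; this is what keeps the mean position at the diffusive
time bounded, since the survival probabilities up to that time add up to the order of its square root only.\<close>

lemma mean_le_sum:
  assumes "0 \<le> x"
  shows "expectation (\<lambda>\<omega>. of_int (pos k i s x n \<omega>))
     \<le> of_int x + 2 / 2^k * (\<Sum>t<n. prob (alive k i s x t))"
proof (induction n)
  case (Suc n)
  then show ?case using mean_step[OF assms, of k i s n] by (simp add: algebra_simps)
qed (simp add: prob_space)

lemma mean_le:
  assumes "0 \<le> x"
  shows "expectation (\<lambda>\<omega>. of_int (pos k i s x n \<omega>)) \<le> of_int x + 2 * real n / 2^k"
proof -
  have "(\<Sum>t<n. prob (alive k i s x t)) \<le> (\<Sum>t<n. 1)"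
    by (intro sum_mono) simp
  then have "2 / 2^k * (\<Sum>t<n. prob (alive k i s x t)) \<le> 2 / 2^k * real n"
    by (intro mult_left_mono) auto
  with mean_le_sum[OF assms, of k i s n] show ?thesis by simp
qed

text \<open>The function \<open>(1 - mu)^y\<close> is subharmonic for a walk with upward bias small compared with \<open>mu\<close>, since its
convexity (of order \<open>mu^2\<close>) beats the drift (of order \<open>mu / 2^k\<close>). The gain is retained: away from \<open>0\<close>
the potential grows by a factor \<open>1 + mu^2 / 4\<close> per step. In the statement the factor \<open>m n - 1 + prob (alive \<dots>)\<close>
is the part of the potential that is carried by the living walks, dead ones having potential \<open>1\<close>.\<close>

lemma potential_step:
  fixes i :: nat and s :: int
  assumes x: "0 \<le> x" and mu: "0 < mu" "mu < 1" "8 / 2^k \<le> mu"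
  defines "m \<equiv> \<lambda>n. expectation (\<lambda>\<omega>. (1 - mu) ^ nat (pos k i s x n \<omega>))"
  shows "m n + mu^2 / 4 * (m n - 1 + prob (alive k i s x n)) \<le> m (Suc n)"
proof -
  define b where "b = 1 - mu"
  have b: "0 < b" using mu by (simp add: b_def)
  let ?f = "\<lambda>y. - (b ^ nat y)"
  let ?g = "\<lambda>y. - (b ^ nat y) - mu^2 / 4 * (b ^ nat y - 1 + (if 0 < y then 1 else 0))"
  have "expectation (\<lambda>\<omega>. ?f (pos k i s x (Suc n) \<omega>)) \<le> expectation (\<lambda>\<omega>. ?g (pos k i s x n \<omega>))"
  proof (rule step_expectation_le[OF x])
    fix y :: int and p :: real
    assume y: "0 < y" and p: "0 \<le> p" "p \<le> 1/2 + 1/2^k"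
    define j where "j = nat (y - 1)"
    have nat: "nat y = Suc j" "nat (y + 1) = Suc (Suc j)" "nat (y - 1) = j"
      using y by (auto simp: j_def)
    have "p * (2 * mu - mu^2) \<le> (1/2 + mu / 8) * (2 * mu - mu^2)"
      using p mu by (intro mult_right_mono) (auto simp: power2_eq_square)
    also have "\<dots> = mu - mu^2 / 2 + mu^2 / 4 - mu^3 / 8"
      by (simp add: algebra_simps power2_eq_square power3_eq_cube)
    also have "\<dots> \<le> mu - mu^2 / 4 + mu^3 / 4"
      using zero_le_power[of mu 3] mu by linarith
    finally have "b * (1 + mu^2 / 4) \<le> p * b^2 + (1 - p)"
      unfolding b_def by (simp add: algebra_simps power2_eq_square power3_eq_cube diff_divide_distrib)
    then have "b ^ j * (b * (1 + mu^2 / 4)) \<le> b ^ j * (p * b^2 + (1 - p))"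
      using b by (intro mult_left_mono) auto
    then show "p * ?f (y + 1) + (1 - p) * ?f (y - 1) \<le> ?g y"
      unfolding nat using y by (simp add: algebra_simps power2_eq_square)
  qed simp
  also have "expectation (\<lambda>\<omega>. ?g (pos k i s x n \<omega>))
    = - m n - mu^2 / 4 * (m n - 1 + prob (alive k i s x n))"
    using pos_integrable[OF x, of "\<lambda>y. b ^ nat y"] pos_integrable[OF x, of "\<lambda>y. if 0 < y then 1 else 0"]
    by (simp add: m_def b_def expectation_alive prob_space)
  finally show ?thesis using pos_integrable[OF x, of "\<lambda>y. b ^ nat y"] by (simp add: m_def b_def)
qed

text \<open>One estimate with two uses. Let \<open>T\<close> be at least of order \<open>1/mu^2\<close>. For \<open>x\<close> small
compared with \<open>1/mu\<close> the chance of survival is at most \<open>mu * x\<close> up to a constant; for \<open>x\<close> of order \<open>1/mu\<close>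
and \<open>T\<close> a large multiple of \<open>1/mu^2\<close> the chance of absorption is bounded below.
It holds because the potential never exceeds \<open>1\<close>, while it grows at a rate \<open>mu^2 / 4\<close> times its living part at each of the \<open>T\<close> steps.\<close>

lemma survival_le:
  assumes x: "0 \<le> x" and mu: "0 < mu" "mu < 1" "8 / 2^k \<le> mu" and T: "0 < T"
  shows "prob (alive k i s x T) \<le> (1 - (1 - mu) ^ nat x) * (1 + 4 / (mu^2 * real T))"
proof -
  define m where "m n = expectation (\<lambda>\<omega>. (1 - mu) ^ nat (pos k i s x n \<omega>))" for n
  define a where "a n = prob (alive k i s x n)" for n
  define h where "h = (1 - mu) ^ nat x"
  have step: "m n + mu^2 / 4 * (m n - 1 + a n) \<le> m (Suc n)" for n
    unfolding m_def a_def by (rule potential_step[OF x mu])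
  have ge: "0 \<le> m n - 1 + a n" for n
  proof -
    have "expectation (\<lambda>\<omega>. 1 - (if 0 < pos k i s x n \<omega> then 1 else 0)) \<le> m n"
      unfolding m_def
    proof (rule integral_mono)
      show "integrable M (\<lambda>\<omega>. 1 - (if 0 < pos k i s x n \<omega> then 1 else (0::real)))"
        using pos_integrable[OF x, of "\<lambda>y. 1 - (if 0 < y then 1 else (0::real))"] by simp
      show "integrable M (\<lambda>\<omega>. (1 - mu) ^ nat (pos k i s x n \<omega>))"
        using pos_integrable[OF x, of "\<lambda>y. (1 - mu) ^ nat y"] by simp
    qed (use mu pos_bounds(1)[OF x] in auto)
    then show ?thesis
      using pos_integrable[OF x, of "\<lambda>y. if 0 < y then 1 else (0::real)"]
      by (simp add: a_def expectation_alive prob_space)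
  qed
  have "m n \<le> m (Suc n)" for n
    using step[of n] mult_nonneg_nonneg[OF _ ge[of n], of "mu^2/4"] by simp
  then have "m 0 \<le> m n" for n by (rule lift_Suc_mono_le) auto
  then have h: "h \<le> m n" for n by (simp add: m_def h_def prob_space)
  have anti: "a T \<le> a n" if "n \<le> T" for n
    unfolding a_def by (intro finite_measure_mono alive_antimono that alive_M)
  define v where "v = mu^2 / 4 * (h - 1 + a T)"
  have "h + real n * v \<le> m n" if "n \<le> T" for n
    using that
  proof (induction n)
    case (Suc n)
    have "v \<le> mu^2 / 4 * (m n - 1 + a n)"
      using h[of n] anti[of n] Suc.prems unfolding v_def by (intro mult_left_mono) auto
    with step[of n] Suc show ?case by (simp add: distrib_right)
  qed (use h in simp)
  from this[of T] have "h + real T * (mu^2 / 4 * (h - 1 + a T)) \<le> m T" by (simp add: v_def)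
  also have "m T \<le> expectation (\<lambda>\<omega>. 1)"
    unfolding m_def
  proof (rule integral_mono)
    show "integrable M (\<lambda>\<omega>. (1 - mu) ^ nat (pos k i s x T \<omega>))"
      using pos_integrable[OF x, of "\<lambda>y. (1 - mu) ^ nat y"] by simp
  qed (use mu in \<open>auto intro: power_le_one\<close>)
  finally have "h + real T * (mu^2 / 4 * (h - 1 + a T)) \<le> 1"
    by (simp add: prob_space)
  then show ?thesis
    using mu T unfolding h_def[symmetric] a_def[symmetric]
    by (simp add: field_simps power2_eq_square)
qed

text \<open>Up to time \<open>4^k\<close> a bias of \<open>1/2^k\<close> is not felt, and the survival probability decays as for the simple
random walk. The constant 9 makes the bound trivial for \<open>t \<le> 81\<close>, so that \<open>mu = 8 / sqrt t\<close> may be taken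
below 1.\<close>

lemma survival_le_sqrt:
  assumes x: "1 \<le> x" and t: "1 \<le> t" "t \<le> 4^k"
  shows "prob (alive k i s x t) \<le> 9 * of_int x / sqrt (real t)"
proof (cases "sqrt (real t) \<le> 9 * of_int x")
  case True
  then have "1 \<le> 9 * of_int x / sqrt (real t)" using t by (simp add: field_simps)
  then show ?thesis using prob_le_1[of "alive k i s x t"] by linarith
next
  case False
  define mu where "mu = 8 / sqrt (real t)"
  have "1 \<le> real_of_int x" using x by simp
  then have st: "8 < sqrt (real t)" using False by linarith
  have "real t \<le> real (4^k)" using t(2) by (simp only: of_nat_le_iff)
  then have "sqrt (real t) \<le> 2^k" by (intro real_le_lsqrt) (auto simp: four_power)
  then have mu: "0 < mu" "mu < 1" "8 / 2^k \<le> mu"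
    unfolding mu_def
  proof -
    have 0: "0 < sqrt (real t)" using st by linarith
    show "0 < 8 / sqrt (real t)" using 0 by (rule divide_pos_pos[rotated]) simp
    show "8 / sqrt (real t) < 1" using 0 st by (simp only: divide_less_eq_1_pos)
    show "8 / 2^k \<le> 8 / sqrt (real t)"
      using 0 \<open>sqrt (real t) \<le> 2^k\<close> by (intro divide_left_mono mult_pos_pos) auto
  qed
  have "1 + real (nat x) * (- mu) \<le> (1 + (- mu)) ^ nat x"
    using mu by (intro Bernoulli_inequality) auto
  then have ber: "1 - (1 - mu) ^ nat x \<le> of_int x * mu"
    using x by simp
  have "mu^2 * real t = 64" using st t by (simp add: mu_def power_divide)
  then have "prob (alive k i s x t) \<le> (1 - (1 - mu) ^ nat x) * (1 + 4 / 64)"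
    using survival_le[of x mu k t i s] x mu t by simp
  also have "\<dots> \<le> of_int x * mu * (1 + 4 / 64)"
    using ber by (intro mult_right_mono) auto
  also have "\<dots> = 17 / 2 * of_int x / sqrt (real t)"
    by (simp add: mu_def)
  also have "\<dots> \<le> 9 * of_int x / sqrt (real t)"
    using x by (intro divide_right_mono) auto
  finally show ?thesis .
qed

text \<open>The position is almost a martingale: the expectation does not grow with \<open>k\<close>, although survivors sit
at height of order \<open>2^k\<close>.\<close>

lemma mean_at_diffusive_time:
  assumes x: "1 \<le> x"
  shows "expectation (\<lambda>\<omega>. of_int (pos k i s x (4^k) \<omega>)) \<le> 39 * real_of_int x"
proof -
  have sum: "(\<Sum>t<Suc n. prob (alive k i s x t)) \<le> 1 + 18 * of_int x * sqrt (real n)"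
    if "n \<le> 4^k" for n
    using that
  proof (induction n)
    case (Suc n)
    have "1 / sqrt (real (Suc n)) \<le> 2 * (sqrt (real (Suc n)) - sqrt (real n))"
    proof -
      have "0 \<le> (sqrt (real (Suc n)) - sqrt (real n))^2" by simp
      also have "\<dots> = real (Suc n) + real n - 2 * sqrt (real (Suc n)) * sqrt (real n)"
        by (simp add: power2_diff)
      finally have "1 \<le> 2 * (sqrt (real (Suc n)) - sqrt (real n)) * sqrt (real (Suc n))"
        by (simp add: algebra_simps)
      then show ?thesis by (simp add: divide_le_eq)
    qed
    then have "9 * of_int x * (1 / sqrt (real (Suc n)))
        \<le> 9 * of_int x * (2 * (sqrt (real (Suc n)) - sqrt (real n)))"
      using x by (intro mult_left_mono) auto
    with survival_le_sqrt[OF x _ Suc.prems, of i s] Suc show ?case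
      by (simp add: algebra_simps)
  qed simp
  have "(\<Sum>t<4^k. prob (alive k i s x t)) \<le> (\<Sum>t<Suc (4^k). prob (alive k i s x t))"
    by simp
  also have "\<dots> \<le> 1 + 18 * of_int x * sqrt (real (4^k))" by (rule sum) simp
  also have "sqrt (real (4^k)) = 2^k"
    by (simp add: four_power)
  finally have "2 / 2^k * (\<Sum>t<4^k. prob (alive k i s x t)) \<le> 2 / 2^k * (1 + 18 * of_int x * 2^k)"
    by (intro mult_left_mono) auto
  also have "\<dots> = 2 / 2^k + 36 * of_int x" by (simp add: field_simps)
  also have "\<dots> \<le> 2 + 36 * of_int x" by (simp add: field_simps)
  finally show ?thesis using mean_le_sum[of x k i s "4^k"] x by simp
qed

text \<open>From the diffusive height \<open>2^k\<close> absorption within diffusive time has a probability bounded below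
independently of the scale.\<close>

lemma uniform_absorption:
  "\<exists>c>0. \<exists>T>0. \<forall>k\<ge>4. \<forall>i s x. 0 \<le> x \<longrightarrow> x \<le> int A * 2^k \<longrightarrow>
     prob (alive k i s x (T * 4^k)) \<le> 1 - c"
proof -
  \<comment> \<open>With \<open>mu = 8 / 2^k\<close> this is a lower bound of \<open>(1 - mu)^x\<close>, as \<open>1 - mu \<ge> exp (- 2 * mu)\<close>.\<close>
  define c where "c = exp (- 16 * real A)"
  have c: "0 < c" by (simp add: c_def)
  obtain T :: nat where T: "1 / (8 * c) < real T" using reals_Archimedean2 by blast
  have T0: "0 < T" using T c by (cases "T = 0") (auto simp: divide_less_0_iff)
  show ?thesis
  proof (intro exI[of _ "c/2"] exI[of _ T] conjI allI impI)
    fix k i s and x :: int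
    assume k: "4 \<le> k" and x: "0 \<le> x" "x \<le> int A * 2^k"
    define mu :: real where "mu = 8 / 2^k"
    have "(2::real)^4 \<le> 2^k" using k by (intro power_increasing) auto
    then have mu: "0 < mu" "mu \<le> 1/2" by (auto simp: mu_def field_simps)
    have "- mu - 2 * mu^2 \<le> ln (1 - mu)"
      using mu by (intro ln_one_minus_pos_lower_bound) auto
    moreover have "2 * mu^2 \<le> mu" using mu by (simp add: power2_eq_square)
    ultimately have "- 2 * mu \<le> ln (1 - mu)" by linarith
    then have "exp (- 2 * mu) \<le> 1 - mu" using mu by (subst (asm) ln_ge_iff) auto
    then have "exp (- 2 * mu) ^ nat x \<le> (1 - mu) ^ nat x"
      by (intro power_mono) auto
    moreover have "c \<le> exp (- 2 * mu) ^ nat x"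
    proof -
      have "real_of_int x \<le> real A * 2^k"
        using x(2) by (simp flip: of_int_le_iff[where 'a = real])
      then have "2 * mu * real_of_int x \<le> 2 * mu * (real A * 2^k)"
        using mu by (intro mult_left_mono) auto
      also have "\<dots> = 16 * real A" by (simp add: mu_def)
      finally have "- 16 * real A \<le> real (nat x) * (- 2 * mu)" using x(1) by (simp add: mult.commute)
      then show ?thesis unfolding c_def by (simp only: exp_le_cancel_iff flip: exp_of_nat_mult)
    qed
    ultimately have h: "c \<le> (1 - mu) ^ nat x" by linarith
    have eq: "mu^2 * real (T * 4^k) = 64 * real T"
      by (simp add: mu_def power_divide four_power)
    have "prob (alive k i s x (T * 4^k)) \<le> (1 - (1 - mu) ^ nat x) * (1 + 4 / (mu^2 * real (T * 4^k)))"
      using x mu T0 by (intro survival_le) (auto simp: mu_def)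
    also have "4 / (mu^2 * real (T * 4^k)) = 1 / (16 * real T)"
      by (subst eq) simp
    finally have "prob (alive k i s x (T * 4^k)) \<le> (1 - (1 - mu) ^ nat x) * (1 + 1 / (16 * real T))" .
    also have "\<dots> \<le> (1 - c) * (1 + 1 / (16 * real T))"
      using h by (intro mult_right_mono) auto
    also have "\<dots> \<le> 1 - c + 1 / (16 * real T)"
      using c T0 by (simp add: field_simps)
    also have "1 / (16 * real T) \<le> c / 2"
      using T c T0 by (simp add: field_simps)
    finally show "prob (alive k i s x (T * 4^k)) \<le> 1 - c / 2" by simp
  qed (use c T0 in auto)
qed

section \<open>Simultaneous extinction\<close>

text \<open>The joint state of the walks of one generation. Beyond \<open>D\<close> the value is fixed to \<open>0\<close>, so that
only finitely many states occur and every property of the state is an event.\<close>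

definition positions :: "nat \<Rightarrow> nat \<Rightarrow> int \<Rightarrow> (nat \<Rightarrow> int) \<Rightarrow> nat \<Rightarrow> 'a \<Rightarrow> nat \<Rightarrow> int" where
  "positions k D s x n \<omega> = (\<lambda>i. if i < D then pos k i s (x i) n \<omega> else 0)"

lemma positions_measurable:
  assumes x: "\<And>i. i < D \<Longrightarrow> 0 \<le> x i"
  shows "\<exists>R. finite R \<and> positions k D s x n \<in> measurable (past (s + int n)) (count_space R)"
proof -
  define b where "b = Max (insert 0 (x ` {..<D})) + int n"
  define R where "R = {f. \<forall>i. (i \<in> {..<D} \<longrightarrow> f i \<in> {0..b}) \<and> (i \<notin> {..<D} \<longrightarrow> f i = (0::int))}"
  have fin: "finite R" unfolding R_def by (intro finite_set_of_finite_funs) auto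
  have pos[measurable]: "pos k i s y n \<in> measurable (past (s + int n)) (count_space UNIV)" for i y
    by (rule pos_past) simp
  have mem: "positions k D s x n \<omega> \<in> R" for \<omega>
  proof -
    have "pos k i s (x i) n \<omega> \<le> b" if "i < D" for i
    proof -
      have "x i \<le> Max (insert 0 (x ` {..<D}))" using that by (intro Max_ge) auto
      then show ?thesis using pos_bounds(2)[OF x[OF that], of k i s n \<omega>] by (simp add: b_def)
    qed
    then show ?thesis using pos_bounds(1)[OF x] by (auto simp: R_def positions_def)
  qed
  have "positions k D s x n \<in> measurable (past (s + int n)) (count_space R)"
  proof (subst measurable_count_space_eq2[OF fin])
    show "positions k D s x n \<in> space (past (s + int n)) \<rightarrow> R \<and>
      (\<forall>y\<in>R. positions k D s x n -` {y} \<inter> space (past (s + int n)) \<in> sets (past (s + int n)))"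
    proof (intro conjI ballI)
      fix y assume y: "y \<in> R"
      have "positions k D s x n -` {y} \<inter> space (past (s + int n))
        = {\<omega> \<in> space (past (s + int n)). \<forall>i\<in>{..<D}. pos k i s (x i) n \<omega> = y i}"
        using y by (auto simp: positions_def R_def fun_eq_iff)
      also have "\<dots> \<in> sets (past (s + int n))" by measurable
      finally show "positions k D s x n -` {y} \<inter> space (past (s + int n)) \<in> sets (past (s + int n))" .
    qed (use mem in auto)
  qed
  with fin show ?thesis by blast
qed

lemma prob_extinction_after_restart:
  assumes x: "\<And>i. i < D \<Longrightarrow> 0 \<le> x i"
    and ge: "\<And>y. P y \<Longrightarrow> (\<And>i. i < D \<Longrightarrow> 0 \<le> y i) \<Longrightarrow>
      c \<le> prob {\<omega> \<in> space M. \<forall>i<D. pos k i (s + int n) (y i) t \<omega> = 0}"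
  shows "{\<omega> \<in> space M. P (positions k D s x n \<omega>)} \<in> events"
    and "c * prob {\<omega> \<in> space M. P (positions k D s x n \<omega>)}
      \<le> prob {\<omega> \<in> space M. P (positions k D s x n \<omega>) \<and> (\<forall>i<D. pos k i s (x i) (n + t) \<omega> = 0)}"
proof -
  let ?X = "positions k D s x n"
  let ?p = "past (s + int n)"
  define E where "E = {\<omega> \<in> space M. P (?X \<omega>)}"
  obtain R where R: "finite R" "?X \<in> measurable ?p (count_space R)"
    using positions_measurable[of D x k s n] x by auto
  have mem: "?X \<omega> \<in> R" if "\<omega> \<in> space M" for \<omega>
    using measurable_space[OF R(2)] that by (simp add: space_past)
  have past: "{\<omega> \<in> space M. Q (?X \<omega>)} \<in> sets ?p" for Q
  proof -
    have "?X -` {y \<in> R. Q y} \<inter> space ?p \<in> sets ?p"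
      by (rule measurable_sets[OF R(2)]) simp
    also have "?X -` {y \<in> R. Q y} \<inter> space ?p = {\<omega> \<in> space M. Q (?X \<omega>)}"
      using mem by (auto simp: space_past)
    finally show ?thesis .
  qed
  show E: "{\<omega> \<in> space M. P (?X \<omega>)} \<in> events" by (rule subsetD[OF sets_past past])
  have Ey: "{\<omega> \<in> E. ?X \<omega> = y} \<in> sets ?p" for y
    using past[of "\<lambda>z. P z \<and> z = y"] by (simp add: E_def conj_assoc)
  define D' where "D' y = {\<omega> \<in> space M. \<forall>i<D. pos k i (s + int n) (y i) t \<omega> = 0}" for y
  have D': "D' y \<in> sets (future (s + int n))" for y
  proof -
    have [measurable]: "pos k i (s + int n) z t \<in> measurable (future (s + int n)) (count_space UNIV)" for i z
      by (rule pos_future) simp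
    have "{\<omega> \<in> space (future (s + int n)). \<forall>i<D. pos k i (s + int n) (y i) t \<omega> = 0} \<in> sets (future (s + int n))"
      by measurable
    then show ?thesis unfolding D'_def space_future .
  qed
  have "c * prob E \<le> prob {\<omega> \<in> E. \<omega> \<in> D' (?X \<omega>)}"
  proof (rule prob_bounded_below_independent_choice[where X = "?X" and D = D' and E = E])
    show "finite (?X ` E)" by (rule finite_subset[OF _ R(1)]) (use mem in \<open>auto simp: E_def\<close>)
    show "E \<in> events" using E by (simp add: E_def)
    show "{\<omega> \<in> E. ?X \<omega> = y} \<in> events" for y by (rule subsetD[OF sets_past Ey])
    show "D' y \<in> events" for y by (rule subsetD[OF sets_future D'])
    show "prob ({\<omega> \<in> E. ?X \<omega> = y} \<inter> D' y) = prob {\<omega> \<in> E. ?X \<omega> = y} * prob (D' y)" for y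
      by (rule indep_past_future[OF Ey D'])
    show "c \<le> prob (D' y)" if "y \<in> ?X ` E" for y
      unfolding D'_def using that pos_bounds(1)[OF x] by (intro ge) (auto simp: E_def positions_def)
  qed
  also have "\<dots> \<le> prob {\<omega> \<in> space M. P (?X \<omega>) \<and> (\<forall>i<D. pos k i s (x i) (n + t) \<omega> = 0)}"
  proof (rule finite_measure_mono)
    show "{\<omega> \<in> E. \<omega> \<in> D' (?X \<omega>)} \<subseteq> {\<omega> \<in> space M. P (?X \<omega>) \<and> (\<forall>i<D. pos k i s (x i) (n + t) \<omega> = 0)}"
      by (auto simp: E_def D'_def positions_def pos_add)
    have "{\<omega> \<in> space M. \<forall>i\<in>{..<D}. pos k i s (x i) (n + t) \<omega> = 0} \<in> events" by measurable
    from sets.Int[OF E this] show "{\<omega> \<in> space M. P (?X \<omega>) \<and> (\<forall>i<D. pos k i s (x i) (n + t) \<omega> = 0)} \<in> events"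
      by (rule back_subst[where P = "\<lambda>A. A \<in> events"]) auto
  qed
  finally show "c * prob {\<omega> \<in> space M. P (?X \<omega>)}
      \<le> prob {\<omega> \<in> space M. P (?X \<omega>) \<and> (\<forall>i<D. pos k i s (x i) (n + t) \<omega> = 0)}"
    by (simp add: E_def)
qed

lemma high_position_prob_le:
  assumes "0 \<le> x" "0 < b"
  shows "prob {\<omega> \<in> space M. b \<le> of_int (pos k i s x n \<omega>)} \<le> (of_int x + 2 * real n / 2^k) / b"
proof -
  have "prob {\<omega> \<in> space M. b \<le> real_of_int (pos k i s x n \<omega>)}
    \<le> expectation (\<lambda>\<omega>. of_int (pos k i s x n \<omega>)) / b"
    using pos_integrable[OF assms(1), of real_of_int] pos_bounds(1)[OF assms(1)] assms(2)
    by (intro integral_Markov_inequality_measure[where A = "space M"]) auto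
  also have "\<dots> \<le> (of_int x + 2 * real n / 2^k) / b"
    using mean_le[OF assms(1)] assms(2) by (intro divide_right_mono) auto
  finally show ?thesis .
qed

text \<open>Boundedly many survivors at diffusive heights all die within a bounded diffusive time, with a
probability that does not depend on the scale. Since the joint law of the walks is unknown, they are
killed one after the other: in each time block one of them is absorbed with probability at least
\<open>c\<close>, whereas by Markov's inequality some other one ends the block above the height \<open>A' * 2^k\<close> with
probability at most \<open>c/2\<close>. The next block starts afresh from there with one walk less.\<close>

lemma uniform_extinction:
  "\<exists>c>0. \<exists>T. \<forall>k\<ge>4. \<forall>D s x. (\<forall>i<D. 0 \<le> x i \<and> x i \<le> int A * 2^k) \<longrightarrow>
     card {i. i < D \<and> 0 < x i} \<le> m \<longrightarrow>
     c \<le> prob {\<omega> \<in> space M. \<forall>i<D. pos k i s (x i) (T * 4^k) \<omega> = 0}"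
proof (induction m arbitrary: A)
  case 0
  show ?case
  proof (intro exI[of _ "1::real"] exI[of _ "0::nat"] conjI allI impI)
    fix k D s and x :: "nat \<Rightarrow> int"
    assume x: "\<forall>i<D. 0 \<le> x i \<and> x i \<le> int A * 2^k" and "card {i. i < D \<and> 0 < x i} \<le> 0"
    then have "{i. i < D \<and> 0 < x i} = {}" by simp
    then have "\<not> 0 < x i" if "i < D" for i using that by blast
    then have "x i = 0" if "i < D" for i using x that by (meson not_less order_antisym)
    then have "{\<omega> \<in> space M. \<forall>i<D. pos k i s (x i) (0 * 4^k) \<omega> = 0} = space M"
      by simp
    then show "1 \<le> prob {\<omega> \<in> space M. \<forall>i<D. pos k i s (x i) (0 * 4^k) \<omega> = 0}"
      by (simp add: prob_space)
  qed simp
next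
  case (Suc m)
  obtain c T where c: "0 < c" and T: "0 < T"
    and abs: "\<And>k i s x. 4 \<le> k \<Longrightarrow> 0 \<le> x \<Longrightarrow> x \<le> int A * 2^k \<Longrightarrow> prob (alive k i s x (T * 4^k)) \<le> 1 - c"
    using uniform_absorption[of A] by blast
  obtain A' :: nat where A': "(real m + 1) * (real A + 2 * real T) * 2 / c < real A'"
    using reals_Archimedean2 by blast
  then have A'0: "0 < A'" using c by (cases "A' = 0") (auto simp: divide_less_0_iff mult_less_0_iff)
  obtain c' T' where c': "0 < c'"
    and IH: "\<And>k D s x. 4 \<le> k \<Longrightarrow> (\<And>i. i < D \<Longrightarrow> 0 \<le> x i \<and> x i \<le> int A' * 2^k) \<Longrightarrow>
     card {i. i < D \<and> 0 < x i} \<le> m \<Longrightarrow>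
     c' \<le> prob {\<omega> \<in> space M. \<forall>i<D. pos k i s (x i) (T' * 4^k) \<omega> = 0}"
    using Suc.IH[of A'] by blast
  show ?case
  proof (intro exI[of _ "c' * (c/2)"] exI[of _ "T + T'"] conjI allI impI)
    show "0 < c' * (c/2)" using c c' by simp
    fix k D s and x :: "nat \<Rightarrow> int"
    assume k: "4 \<le> k" and x: "\<forall>i<D. 0 \<le> x i \<and> x i \<le> int A * 2^k"
      and card: "card {i. i < D \<and> 0 < x i} \<le> Suc m"
    define S where "S = {i. i < D \<and> 0 < x i}"
    have finS: "finite S" by (simp add: S_def)
    define n where "n = T * 4^k"
    define j where "j = (if S = {} then 0 else (SOME j. j \<in> S))"
    have j: "j \<in> S" if "S \<noteq> {}" using that by (simp add: j_def some_in_eq)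
    \<comment> \<open>The walk killed in the first block; if there is none alive, a walk started at \<open>0\<close> serves as dummy.\<close>
    define x' where "x' = (if j \<in> S then x j else 0)"
    define P where "P y \<longleftrightarrow> (\<forall>i<D. y i \<le> int A' * 2^k) \<and> card {i. i < D \<and> 0 < y i} \<le> m"
      for y :: "nat \<Rightarrow> int"
    define high where "high i = {\<omega> \<in> space M. real A' * 2^k \<le> of_int (pos k i s (x i) n \<omega>)}" for i
    have [measurable]: "high i \<in> events" for i unfolding high_def by measurable
    let ?E = "{\<omega> \<in> space M. P (positions k D s x n \<omega>)}"
    have dead: "pos k i s (x i) n \<omega> = 0" if "i < D" "i \<notin> S" for i \<omega>
      using pos_stays[where m = 0 and n = n and x = "x i" and k = k and i = i and s = s and \<omega> = \<omega>] x that
      by (auto simp: S_def not_less intro: antisym)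
    have sub: "space M - ?E \<subseteq> alive k j s x' n \<union> (\<Union>i\<in>S. high i)"
    proof (rule subsetI, rule ccontr)
      fix \<omega> assume w: "\<omega> \<in> space M - ?E" "\<omega> \<notin> alive k j s x' n \<union> (\<Union>i\<in>S. high i)"
      have "pos k i s (x i) n \<omega> \<le> int A' * 2^k" if "i < D" for i
      proof (cases "i \<in> S")
        case True
        then have "real_of_int (pos k i s (x i) n \<omega>) < real_of_int (int A' * 2^k)"
          using w by (auto simp: high_def)
        then show ?thesis by (simp only: of_int_less_iff)
      qed (use that dead in simp)
      moreover have "card {i. i < D \<and> 0 < pos k i s (x i) n \<omega>} \<le> m"
      proof (cases "S = {}")
        case True
        then have "{i. i < D \<and> 0 < pos k i s (x i) n \<omega>} = {}" using dead by force
        then show ?thesis by (metis card.empty le0)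
      next
        case False
        have "{i. i < D \<and> 0 < pos k i s (x i) n \<omega>} \<subseteq> S - {j}"
          using dead w j[OF False] by (force simp: alive_def x'_def)
        then have "card {i. i < D \<and> 0 < pos k i s (x i) n \<omega>} \<le> card (S - {j})"
          using finS by (intro card_mono) auto
        also have "\<dots> \<le> m" using j[OF False] card finS by (simp add: S_def)
        finally show ?thesis .
      qed
      ultimately have "P (positions k D s x n \<omega>)"
        by (simp add: P_def positions_def cong: conj_cong)
      then show False using w by simp
    qed
    have pS: "prob (\<Union>i\<in>S. high i) \<le> c / 2"
    proof -
      have "prob (\<Union>i\<in>S. high i) \<le> (\<Sum>i\<in>S. prob (high i))"
        by (intro finite_measure_subadditive_finite finS) auto
      also have "\<dots> \<le> (\<Sum>i\<in>S. (real A + 2 * real T) / real A')"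
      proof (rule sum_mono)
        fix i assume "i \<in> S"
        then have xi: "0 \<le> x i" "real_of_int (x i) \<le> real_of_int (int A * 2^k)"
          using x by (auto simp: S_def of_int_le_iff simp del: of_int_mult)
        have "prob (high i) \<le> (of_int (x i) + 2 * real n / 2^k) / (real A' * 2^k)"
          unfolding high_def using xi A'0 by (intro high_position_prob_le) auto
        also have "\<dots> \<le> (real A * 2^k + 2 * real T * 2^k) / (real A' * 2^k)"
          using xi by (intro divide_right_mono add_mono) (auto simp: n_def four_power power2_eq_square)
        also have "\<dots> = (real A + 2 * real T) / real A'"
          by (simp add: distrib_right[symmetric])
        finally show "prob (high i) \<le> (real A + 2 * real T) / real A'" .
      qed
      also have "\<dots> = real (card S) * ((real A + 2 * real T) / real A')" by simp
      also have "\<dots> \<le> (real m + 1) * ((real A + 2 * real T) / real A')"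
        using card by (intro mult_right_mono) (auto simp: S_def)
      also have "\<dots> \<le> c / 2" using A' A'0 c by (simp add: field_simps)
      finally show ?thesis .
    qed
    have xj: "0 \<le> x'" "x' \<le> int A * 2^k" using x by (auto simp: x'_def S_def)
    have Eev: "?E \<in> events"
      by (rule prob_extinction_after_restart(1)[where c = 0]) (use x in auto)
    have "1 - prob ?E = prob (space M - ?E)"
      using Eev by (simp add: prob_compl)
    also have "\<dots> \<le> prob (alive k j s x' n \<union> (\<Union>i\<in>S. high i))"
      using finS by (intro finite_measure_mono sub) auto
    also have "\<dots> \<le> prob (alive k j s x' n) + prob (\<Union>i\<in>S. high i)"
      using finS by (intro measure_Un_le) auto
    also have "\<dots> \<le> (1 - c) + c / 2"
      unfolding n_def by (intro add_mono abs k xj pS[unfolded n_def])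
    finally have "c / 2 \<le> prob ?E" by simp
    then have "c' * (c / 2) \<le> c' * prob ?E" using c' by (intro mult_left_mono) auto
    also have "\<dots> \<le> prob {\<omega> \<in> space M. P (positions k D s x n \<omega>) \<and> (\<forall>i<D. pos k i s (x i) (n + T' * 4^k) \<omega> = 0)}"
      by (rule prob_extinction_after_restart(2)) (use x IH[OF k] in \<open>auto simp: P_def\<close>)
    also have "\<dots> \<le> prob {\<omega> \<in> space M. \<forall>i<D. pos k i s (x i) (n + T' * 4^k) \<omega> = 0}"
    proof (rule finite_measure_mono)
      show "{\<omega> \<in> space M. \<forall>i<D. pos k i s (x i) (n + T' * 4^k) \<omega> = 0} \<in> events"
        by measurable
    qed auto
    finally show "c' * (c / 2) \<le> prob {\<omega> \<in> space M. \<forall>i<D. pos k i s (x i) ((T + T') * 4^k) \<omega> = 0}"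
      by (simp add: n_def distrib_right)
  qed
qed

lemma arr_refine_iterate: "arr (k + r) i z \<omega> \<le> arr k (i div 2^r) z \<omega>"
proof (induction r arbitrary: i)
  case (Suc r)
  have "arr (k + Suc r) i z \<omega> \<le> arr (k + r) (i div 2) z \<omega>"
    using arr_refine[of "k + r" i z \<omega>] by simp
  also have "\<dots> \<le> arr k (i div 2 div 2^r) z \<omega>" by (rule Suc.IH)
  finally show ?case by (simp add: div_mult2_eq)
qed simp

lemma pos_refine:
  assumes "0 \<le> x" "even (x + s)"
  shows "pos (k + r) i s x n \<omega> \<le> pos k (i div 2^r) s x n \<omega>"
  unfolding pos_def by (rule absorbed_mono) (use assms arr_sign arr_refine_iterate in auto)

text \<open>At generation \<open>k\<close> there are \<open>H * 2^k\<close> walks, each of which survives until \<open>4^k\<close> with probability of order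
\<open>2^(-k)\<close>: the expected number of survivors stays bounded but does not tend to \<open>0\<close>. Extinction holds as
for a critical branching process. If survival had a positive limiting probability \<open>b\<close>, then at every
generation, with probability at least \<open>b/2\<close>, there would be between 1 and \<open>m\<close> survivors, of height at
most \<open>A * 2^k\<close>. By uniform extinction a fixed share of this event is lost before
generation \<open>k + r\<close>, because the walks of later generations lie below those of generation \<open>k\<close>. So the probabilities would drop by a fixed amount
from generation \<open>k\<close> to \<open>k + r\<close>, for every \<open>k\<close>, which contradicts their convergence.\<close>

lemma some_survivor_prob_tendsto_0:
  assumes x: "1 \<le> x" and par: "even (x + s)"
  shows "(\<lambda>k. prob (\<Union>i<H * 2^k. alive k i s x (4^k))) \<longlonglongrightarrow> 0"
proof -
  define B where "B k = (\<Union>i<H * 2^k. alive k i s x (4^k))" for k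
  have [measurable]: "B k \<in> events" for k unfolding B_def by auto
  have x0: "0 \<le> x" using x by simp
  have later: "\<omega> \<in> alive k (i div 2^r) s x n"
    if "\<omega> \<in> alive (k + r) i s x (4^(k + r))" "n \<le> 4^(k + r)" for \<omega> i k r n
  proof -
    have "\<omega> \<in> alive (k + r) i s x n" using alive_antimono[OF that(2)] that(1) by blast
    then show ?thesis using pos_refine[OF x0 par, of k r i n \<omega>] by (auto simp: alive_def)
  qed
  have div_less: "i div 2^r < H * 2^k" if "i < H * 2^(k + r)" for i k r :: nat
    using that by (intro less_mult_imp_div_less) (simp add: power_add mult.assoc)
  have "B (Suc k) \<subseteq> B k" for k
  proof
    fix \<omega> assume "\<omega> \<in> B (Suc k)"
    then obtain i where i: "i < H * 2^(k + 1)" "\<omega> \<in> alive (k + 1) i s x (4^(k + 1))"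
      by (auto simp: B_def)
    show "\<omega> \<in> B k"
      unfolding B_def using div_less[OF i(1)] later[OF i(2), of "4^k"] by auto
  qed
  then have dec: "decseq (\<lambda>k. prob (B k))"
    by (intro decseq_SucI finite_measure_mono) auto
  obtain b where b: "(\<lambda>k. prob (B k)) \<longlonglongrightarrow> b" "\<And>k. b \<le> prob (B k)"
    using decseq_convergent[OF dec, of 0] by auto
  have "b = 0"
  proof (rule ccontr)
    assume "b \<noteq> 0"
    moreover have "0 \<le> b" by (rule LIMSEQ_le_const[OF b(1)]) auto
    ultimately have b0: "0 < b" by simp
    \<comment> \<open>\<open>9 * h\<close> bounds the expected number of survivors and \<open>39 * h * 2^k\<close> the expected sum of their heights;
      \<open>m\<close> and \<open>A\<close> make each of the two exceptional events less likely than \<open>b / 4\<close>.\<close>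
    define h where "h = real H * of_int x"
    have h0: "0 \<le> h" using x by (simp add: h_def)
    obtain m :: nat where m: "36 * h / b < real m" using reals_Archimedean2 by blast
    obtain A :: nat where A: "156 * h / b < real A" using reals_Archimedean2 by blast
    have m0: "0 < real m" and A0: "0 < real A"
      using m A b0 h0 by (meson divide_nonneg_pos le_less_trans mult_nonneg_nonneg zero_le_numeral)+
    obtain c T where c: "0 < c" and ext: "\<And>k D s x. 4 \<le> k \<Longrightarrow> (\<And>i. i < D \<Longrightarrow> 0 \<le> x i \<and> x i \<le> int A * 2^k) \<Longrightarrow>
       card {i. i < D \<and> 0 < x i} \<le> m \<Longrightarrow>
       c \<le> prob {\<omega> \<in> space M. \<forall>i<D. pos k i s (x i) (T * 4^k) \<omega> = 0}"
      using uniform_extinction[of A m] by blast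
    define r where "r = Suc T"
    have "T < 2^T" by (rule less_exp)
    also have "(2::nat)^T \<le> 4^T" by (intro power_mono) auto
    finally have rT: "1 + T \<le> 4^r" by (simp add: r_def)
    have drop: "c * (b / 2) \<le> prob (B k) - prob (B (k + r))" if k: "4 \<le> k" for k
    proof -
      define D where "D = H * 2^k"
      define P where "P y \<longleftrightarrow> (\<exists>i<D. 0 < y i) \<and> (\<forall>i<D. y i \<le> int A * 2^k) \<and> card {i. i < D \<and> 0 < y i} \<le> m"
        for y :: "nat \<Rightarrow> int"
      let ?X = "positions k D s (\<lambda>_. x) (4^k)"
      let ?E = "{\<omega> \<in> space M. P (?X \<omega>)}"
      define N where "N \<omega> = (\<Sum>i<D. if 0 < pos k i s x (4^k) \<omega> then 1 else 0 :: real)" for \<omega>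
      define Y where "Y \<omega> = (\<Sum>i<D. real_of_int (pos k i s x (4^k) \<omega>))" for \<omega>
      have [measurable]: "N \<in> borel_measurable M" "Y \<in> borel_measurable M"
        unfolding N_def Y_def by measurable
      have intN: "integrable M N" and intY: "integrable M Y"
        unfolding N_def Y_def
        using pos_integrable[OF x0, of "\<lambda>y. if 0 < y then 1 else 0"] pos_integrable[OF x0, of real_of_int]
        by auto
      have EN: "expectation N \<le> 9 * h"
      proof -
        have "expectation N = (\<Sum>i<D. prob (alive k i s x (4^k)))"
          unfolding N_def using pos_integrable[OF x0, of "\<lambda>y. if 0 < y then 1 else 0"]
          by (subst Bochner_Integration.integral_sum) (auto simp: expectation_alive)
        also have "\<dots> \<le> (\<Sum>i<D. 9 * of_int x / 2^k)"
        proof (rule sum_mono)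
          fix i
          show "prob (alive k i s x (4^k)) \<le> 9 * of_int x / 2^k"
            using survival_le_sqrt[OF x, of "4^k" k i s] by (simp add: four_power)
        qed
        also have "\<dots> = 9 * h" by (simp add: D_def h_def)
        finally show ?thesis .
      qed
      have EY: "expectation Y \<le> 39 * h * 2^k"
      proof -
        have "expectation Y = (\<Sum>i<D. expectation (\<lambda>\<omega>. real_of_int (pos k i s x (4^k) \<omega>)))"
          unfolding Y_def using pos_integrable[OF x0, of real_of_int]
          by (subst Bochner_Integration.integral_sum) auto
        also have "\<dots> \<le> (\<Sum>i<D. 39 * real_of_int x)"
          by (intro sum_mono mean_at_diffusive_time x)
        also have "\<dots> = 39 * h * 2^k" by (simp add: D_def h_def)
        finally show ?thesis .
      qed
      have nn: "0 \<le> N \<omega>" "0 \<le> Y \<omega>" for \<omega>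
        using pos_bounds(1)[OF x0] by (auto simp: N_def Y_def intro!: sum_nonneg)
      have pN: "prob {\<omega> \<in> space M. real m \<le> N \<omega>} \<le> b / 4"
      proof -
        have "prob {\<omega> \<in> space M. real m \<le> N \<omega>} \<le> expectation N / real m"
          using intN nn m0 by (intro integral_Markov_inequality_measure[where A = "space M"]) auto
        also have "\<dots> \<le> 9 * h / real m" using EN m0 by (intro divide_right_mono) auto
        also have "\<dots> \<le> b / 4" using m m0 b0 by (simp add: field_simps)
        finally show ?thesis .
      qed
      have pY: "prob {\<omega> \<in> space M. real A * 2^k \<le> Y \<omega>} \<le> b / 4"
      proof -
        have "prob {\<omega> \<in> space M. real A * 2^k \<le> Y \<omega>} \<le> expectation Y / (real A * 2^k)"
          using intY nn A0 by (intro integral_Markov_inequality_measure[where A = "space M"]) auto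
        also have "\<dots> \<le> 39 * h * 2^k / (real A * 2^k)" using EY A0 by (intro divide_right_mono) auto
        also have "\<dots> = 39 * h / real A" by simp
        also have "\<dots> \<le> b / 4" using A A0 b0 by (simp add: field_simps)
        finally show ?thesis .
      qed
      have sub: "B k \<subseteq> ?E \<union> ({\<omega> \<in> space M. real m \<le> N \<omega>} \<union> {\<omega> \<in> space M. real A * 2^k \<le> Y \<omega>})"
      proof (rule subsetI, rule ccontr)
        fix \<omega> assume w: "\<omega> \<in> B k"
          "\<omega> \<notin> ?E \<union> ({\<omega> \<in> space M. real m \<le> N \<omega>} \<union> {\<omega> \<in> space M. real A * 2^k \<le> Y \<omega>})"
        then have ws: "\<omega> \<in> space M" by (auto simp: B_def alive_def)
        have "N \<omega> < real m" "Y \<omega> < real A * 2^k" using w ws by auto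
        have "real (card {i. i < D \<and> 0 < pos k i s x (4^k) \<omega>}) = N \<omega>"
        proof -
          have "N \<omega> = (\<Sum>i\<in>{i. i < D \<and> 0 < pos k i s x (4^k) \<omega>}. 1)"
            unfolding N_def by (intro sum.mono_neutral_cong_right) auto
          then show ?thesis by simp
        qed
        then have card: "card {i. i < D \<and> 0 < pos k i s x (4^k) \<omega>} \<le> m"
          using \<open>N \<omega> < real m\<close> by linarith
        have high: "pos k i s x (4^k) \<omega> \<le> int A * 2^k" if "i < D" for i
        proof -
          have "real_of_int (pos k i s x (4^k) \<omega>) \<le> Y \<omega>"
            unfolding Y_def using that pos_bounds(1)[OF x0]
            by (intro member_le_sum[where f = "\<lambda>i. real_of_int (pos k i s x (4^k) \<omega>)"]) auto
          with \<open>Y \<omega> < real A * 2^k\<close>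
          have "real_of_int (pos k i s x (4^k) \<omega>) < real_of_int (int A * 2^k)" by simp
          then show ?thesis by (simp only: of_int_less_iff)
        qed
        have "\<exists>i<D. 0 < pos k i s x (4^k) \<omega>"
          using w(1) by (auto simp: B_def alive_def D_def)
        with card high have "P (?X \<omega>)"
          by (simp add: P_def positions_def cong: conj_cong)
        then show False using w ws by simp
      qed
      have Eev: "?E \<in> events"
        by (rule prob_extinction_after_restart(1)[where c = 0]) (use x0 in auto)
      have "b \<le> prob (B k)" by (rule b(2))
      also have "\<dots> \<le> prob (?E \<union> ({\<omega> \<in> space M. real m \<le> N \<omega>} \<union> {\<omega> \<in> space M. real A * 2^k \<le> Y \<omega>}))"
        using Eev by (intro finite_measure_mono sub) auto
      also have "\<dots> \<le> prob ?E + prob ({\<omega> \<in> space M. real m \<le> N \<omega>} \<union> {\<omega> \<in> space M. real A * 2^k \<le> Y \<omega>})"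
        using Eev by (intro measure_Un_le) auto
      also have "prob ({\<omega> \<in> space M. real m \<le> N \<omega>} \<union> {\<omega> \<in> space M. real A * 2^k \<le> Y \<omega>})
         \<le> prob {\<omega> \<in> space M. real m \<le> N \<omega>} + prob {\<omega> \<in> space M. real A * 2^k \<le> Y \<omega>}"
        by (intro measure_Un_le) auto
      finally have "b / 2 \<le> prob ?E" using pN pY by simp
      then have "c * (b / 2) \<le> c * prob ?E" using c by (intro mult_left_mono) auto
      also have "\<dots> \<le> prob {\<omega> \<in> space M. P (?X \<omega>) \<and> (\<forall>i<D. pos k i s x (4^k + T * 4^k) \<omega> = 0)}"
        by (rule prob_extinction_after_restart(2)) (use x0 ext[OF k] in \<open>auto simp: P_def\<close>)
      also have "\<dots> \<le> prob (B k - B (k + r))"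
      proof (rule finite_measure_mono)
        show "{\<omega> \<in> space M. P (?X \<omega>) \<and> (\<forall>i<D. pos k i s x (4^k + T * 4^k) \<omega> = 0)} \<subseteq> B k - B (k + r)"
        proof safe
          fix \<omega> assume w: "\<omega> \<in> space M" "P (?X \<omega>)" "\<forall>i<D. pos k i s x (4^k + T * 4^k) \<omega> = 0"
          then show "\<omega> \<in> B k" by (auto simp: P_def positions_def B_def alive_def D_def)
          assume "\<omega> \<in> B (k + r)"
          then obtain i where i: "i < H * 2^(k + r)" "\<omega> \<in> alive (k + r) i s x (4^(k + r))"
            by (auto simp: B_def)
          have "4^k + T * 4^k = 4^k * (1 + T)" by simp
          also have "\<dots> \<le> 4^k * 4^r" by (intro mult_left_mono rT) auto
          also have "\<dots> = 4^(k + r)" by (simp add: power_add)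
          finally have "\<omega> \<in> alive k (i div 2^r) s x (4^k + T * 4^k)" by (rule later[OF i(2)])
          with w(3) div_less[OF i(1)] show False by (auto simp: alive_def D_def)
        qed
      qed auto
      also have "\<dots> = prob (B k) - prob (B (k + r))"
      proof (rule finite_measure_Diff)
        show "B (k + r) \<subseteq> B k"
          using decseqD[of B] \<open>\<And>k. B (Suc k) \<subseteq> B k\<close> by (simp add: decseq_Suc_iff decseq_def)
      qed auto
      finally show ?thesis .
    qed
    have "(\<lambda>k. prob (B k) - prob (B (k + r))) \<longlonglongrightarrow> b - b"
      by (intro tendsto_diff b(1) LIMSEQ_ignore_initial_segment)
    then have "c * (b / 2) \<le> b - b"
      by (rule LIMSEQ_le_const) (use drop in auto)
    then show False using c b0 by (simp add: mult_le_0_iff)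
  qed
  with b(1) show ?thesis by (simp add: B_def)
qed

end

section \<open>Clocks and marks\<close>

text \<open>The Erlang densities sum to 1 on the positive axis: they are the intensities of the successive rings,
and together these form the rate-one Poisson process.\<close>

lemma erlang_density_partial_sum_le: "(\<Sum>n<m. erlang_density n 1 x) \<le> 1"
proof (cases "x < 0")
  case False
  have "(\<Sum>n<m. x^n /\<^sub>R fact n) \<le> (\<Sum>n. x^n /\<^sub>R fact n)"
    by (rule sum_le_suminf[OF summable_exp_generic]) (use False in auto)
  then have "(\<Sum>n<m. x^n / fact n) \<le> exp x"
    by (simp add: exp_def divide_inverse mult.commute)
  then have "(\<Sum>n<m. x^n / fact n) * exp (- x) \<le> exp x * exp (- x)"
    by (intro mult_right_mono) auto
  also have "\<dots> = 1" by (simp flip: exp_add)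
  finally show ?thesis using False
    by (simp add: erlang_density_def sum_distrib_right)
qed (simp add: erlang_density_def)

lemma erlang_CDF_tendsto_0:
  assumes "0 \<le> x"
  shows "(\<lambda>n. erlang_CDF n 1 x) \<longlonglongrightarrow> 0"
proof -
  have "(\<lambda>n. x^n /\<^sub>R fact n) sums exp x" by (rule exp_converges)
  then have "(\<lambda>n. \<Sum>i\<le>n. x^i /\<^sub>R fact i) \<longlonglongrightarrow> exp x" by (simp add: sums_def_le)
  then have "(\<lambda>n. 1 - (\<Sum>i\<le>n. x^i /\<^sub>R fact i) * exp (- x)) \<longlonglongrightarrow> 1 - exp x * exp (- x)"
    by (intro tendsto_intros)
  also have "1 - exp x * exp (- x) = 0" by (simp flip: exp_add)
  also have "(\<lambda>n. 1 - (\<Sum>i\<le>n. x^i /\<^sub>R fact i) * exp (- x)) = (\<lambda>n. erlang_CDF n 1 x)"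
    using assms by (auto simp: erlang_CDF_def sum_distrib_left divide_inverse mult_ac)
  finally show ?thesis .
qed

context dynamical_discrete_web
begin

definition source :: "(int \<times> int) \<times> nat + (int \<times> int) \<times> nat \<Rightarrow> 'a \<Rightarrow> real" where
  "source = case_sum (\<lambda>(z, n). gap z n) (\<lambda>(z, n) \<omega>. real_of_int (mark z n \<omega>))"

definition labels :: "(int \<times> int) set \<Rightarrow> ((int \<times> int) \<times> nat + (int \<times> int) \<times> nat) set" where
  "labels Z = ((even_lattice \<inter> Z) \<times> UNIV) <+> ((even_lattice \<inter> Z) \<times> UNIV)"

definition generated :: "((int \<times> int) \<times> nat + (int \<times> int) \<times> nat) set \<Rightarrow> 'a measure" where
  "generated K = sigma (space M) (\<Union>i\<in>K. {source i -` A \<inter> space M | A. A \<in> sets borel})"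

lemma indep_source: "indep_vars (\<lambda>_. borel) source (labels UNIV)"
  using independent by (simp add: source_def labels_def)

lemma source_random: "i \<in> labels UNIV \<Longrightarrow> random_variable borel (source i)"
  using indep_source by (auto simp: indep_vars_def2)

lemma space_generated [simp]: "space (generated K) = space M"
  by (simp add: generated_def space_measure_of_conv)

lemma sets_generated:
  "sets (generated K) = sigma_sets (space M) (\<Union>i\<in>K. {source i -` A \<inter> space M | A. A \<in> sets borel})"
  unfolding generated_def by (rule sets_measure_of) auto

lemma source_generated: "i \<in> K \<Longrightarrow> source i \<in> borel_measurable (generated K)"
  by (rule measurableI) (auto simp: sets_generated intro!: sigma_sets.Basic)

lemma sets_generated_subset: "K \<subseteq> labels UNIV \<Longrightarrow> sets (generated K) \<subseteq> events"
  unfolding sets_generated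
  by (rule sets.sigma_sets_subset) (auto dest!: source_random subsetD intro: measurable_sets)

lemma generated_indep:
  assumes K: "K \<subseteq> labels UNIV" "L \<subseteq> labels UNIV" "K \<inter> L = {}"
    and A: "A \<in> sets (generated K)" "B \<in> sets (generated L)"
  shows "prob (A \<inter> B) = prob A * prob B"
proof -
  let ?E = "\<lambda>i. {source i -` A \<inter> space M | A. A \<in> sets borel}"
  have "indep_sets ?E (labels UNIV)" using indep_source by (simp add: indep_vars_def2)
  then have E: "indep_sets ?E (\<Union>j\<in>UNIV. if j then K else L)"
    by (rule indep_sets_mono_index[rotated]) (use K in \<open>auto split: if_splits\<close>)
  have "indep_sets (\<lambda>j. sigma_sets (space M) (\<Union>i\<in>(if j then K else L). ?E i)) (UNIV :: bool set)"
  proof (rule indep_sets_collect_sigma[OF E])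
    show "Int_stable (?E i)" for i
    proof (rule Int_stableI)
      fix a b assume "a \<in> ?E i" "b \<in> ?E i"
      then obtain A' B' where "a = source i -` A' \<inter> space M" "b = source i -` B' \<inter> space M"
        "A' \<in> sets borel" "B' \<in> sets borel" by auto
      then have "a \<inter> b = source i -` (A' \<inter> B') \<inter> space M" "A' \<inter> B' \<in> sets borel" by auto
      then show "a \<inter> b \<in> ?E i" by blast
    qed
    show "disjoint_family_on (\<lambda>j. if j then K else L) UNIV"
      using K by (auto simp: disjoint_family_on_def)
  qed
  from indep_setsD[OF this, of UNIV "\<lambda>j. if j then A else B"]
  have "prob (\<Inter>j\<in>UNIV. if j then A else B) = (\<Prod>j\<in>UNIV. prob (if j then A else B))"
    using A by (simp add: sets_generated split: if_split)
  then show ?thesis by (simp add: UNIV_bool Int_commute mult.commute)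
qed

lemma gap_generated:
  assumes "Inl (z, n) \<in> K"
  shows "gap z n \<in> borel_measurable (generated K)"
  using source_generated[OF assms] by (simp add: source_def)

lemma mark_generated:
  assumes "Inr (z, n) \<in> K"
  shows "mark z n \<in> measurable (generated K) (count_space UNIV)"
proof -
  have [measurable]: "(\<lambda>\<omega>. real_of_int (mark z n \<omega>)) \<in> borel_measurable (generated K)"
    using source_generated[OF assms] by (simp add: source_def)
  have "(\<lambda>\<omega>. \<lfloor>real_of_int (mark z n \<omega>)\<rfloor>) \<in> measurable (generated K) (count_space UNIV)"
    by measurable
  then show ?thesis by simp
qed

lemma ring_time_generated:
  assumes "\<And>n. Inl (z, n) \<in> K"
  shows "ring_time (gap z) n \<in> borel_measurable (generated K)"
proof -
  have [measurable]: "gap z k \<in> borel_measurable (generated K)" for k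
    by (rule gap_generated[OF assms])
  show ?thesis unfolding ring_time_def[abs_def] by measurable
qed

lemma labels_memI: "z \<in> even_lattice \<Longrightarrow> z \<in> Z \<Longrightarrow> Inl (z, n) \<in> labels Z"
  "z \<in> even_lattice \<Longrightarrow> z \<in> Z \<Longrightarrow> Inr (z, n) \<in> labels Z"
  by (auto simp: labels_def)

lemma labels_mono: "labels Z \<subseteq> labels UNIV"
  by (auto simp: labels_def)

lemma generated_M: "K \<subseteq> labels UNIV \<Longrightarrow> f \<in> measurable (generated K) N \<Longrightarrow> f \<in> measurable M N"
  unfolding measurable_def space_generated using sets_generated_subset[of K] by blast

lemma ring_time_M: "z \<in> even_lattice \<Longrightarrow> ring_time (gap z) n \<in> borel_measurable M"
  by (rule generated_M[OF order_refl ring_time_generated]) (auto intro: labels_memI)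

lemma ring_time_distributed:
  assumes z: "z \<in> even_lattice"
  shows "distributed M lborel (ring_time (gap z) (Suc n)) (erlang_density n 1)"
proof -
  let ?I = "(\<lambda>k. Inl (z, k)) ` {..<Suc n} :: ((int \<times> int) \<times> nat + (int \<times> int) \<times> nat) set"
  have inj: "inj_on (\<lambda>k. Inl (z, k) :: (int \<times> int) \<times> nat + (int \<times> int) \<times> nat) {..<Suc n}"
    by (auto simp: inj_on_def)
  have "distributed M lborel (\<lambda>\<omega>. \<Sum>i\<in>?I. source i \<omega>) (erlang_density (card ?I - 1) 1)"
  proof (rule exponential_distributed_sum)
    show "indep_vars (\<lambda>_. borel) source ?I"
      by (rule indep_vars_subset[OF indep_source]) (use z in \<open>auto intro: labels_memI\<close>)
  qed (use gap_exponential[OF z] in \<open>auto simp: source_def\<close>)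
  also have "card ?I = Suc n" using card_image[OF inj] by simp
  also have "(\<lambda>\<omega>. \<Sum>i\<in>?I. source i \<omega>) = ring_time (gap z) (Suc n)"
    unfolding ring_time_def sum.reindex[OF inj] by (simp add: source_def)
  finally show ?thesis by simp
qed

lemma expected_rings_le:
  assumes z: "z \<in> even_lattice" and ab: "a \<le> b"
  shows "(\<Sum>n<m. prob {\<omega> \<in> space M. a < ring_time (gap z) (Suc n) \<omega> \<and> ring_time (gap z) (Suc n) \<omega> < b}) \<le> b - a"
proof -
  let ?p = "\<lambda>n. prob {\<omega> \<in> space M. a < ring_time (gap z) (Suc n) \<omega> \<and> ring_time (gap z) (Suc n) \<omega> < b}"
  have p: "ennreal (?p n) = (\<integral>\<^sup>+x. ennreal (erlang_density n 1 x) * indicator {a<..<b} x \<partial>lborel)" for n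
  proof -
    have "ring_time (gap z) (Suc n) -` {a<..<b} \<inter> space M =
       {\<omega> \<in> space M. a < ring_time (gap z) (Suc n) \<omega> \<and> ring_time (gap z) (Suc n) \<omega> < b}"
      by auto
    with distributed_emeasure[OF ring_time_distributed[OF z], of "{a<..<b}" n] show ?thesis
      by (simp add: emeasure_eq_measure)
  qed
  have "ennreal (\<Sum>n<m. ?p n) = (\<Sum>n<m. ennreal (?p n))" by simp
  also have "\<dots> = (\<integral>\<^sup>+x. (\<Sum>n<m. ennreal (erlang_density n 1 x) * indicator {a<..<b} x) \<partial>lborel)"
    unfolding p by (subst nn_integral_sum) auto
  also have "\<dots> \<le> (\<integral>\<^sup>+x. indicator {a<..<b} x \<partial>lborel)"
  proof (rule nn_integral_mono)
    fix x :: real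
    have "(\<Sum>n<m. ennreal (erlang_density n 1 x)) = ennreal (\<Sum>n<m. erlang_density n 1 x)" by simp
    also have "\<dots> \<le> 1" using erlang_density_partial_sum_le[of x m] by simp
    finally show "(\<Sum>n<m. ennreal (erlang_density n 1 x) * indicator {a<..<b} x) \<le> indicator {a<..<b} x"
      by (auto simp: indicator_def)
  qed
  also have "\<dots> = ennreal (b - a)" using ab by simp
  finally show ?thesis using ab by (simp add: sum_nonneg)
qed

text \<open>The ring times exceed every bound because the \<open>n\<close>-th Erlang distribution function tends to \<open>0\<close>.
The index \<open>n\<close> belongs to the last ring before the first one after \<open>\<tau>\<close>.\<close>

lemma ring_times_unbounded:
  assumes z: "z \<in> even_lattice"
  shows "AE \<omega> in M. \<forall>\<tau>\<ge>0. \<exists>n. ring_time (gap z) n \<omega> \<le> \<tau> \<and> \<tau> < ring_time (gap z) (Suc n) \<omega>"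
proof -
  have [measurable]: "ring_time (gap z) n \<in> borel_measurable M" for n by (rule ring_time_M[OF z])
  have "AE \<omega> in M. \<exists>n. real j < ring_time (gap z) n \<omega>" for j :: nat
  proof -
    define Z where "Z = {\<omega> \<in> space M. \<forall>n. ring_time (gap z) n \<omega> \<le> real j}"
    have [measurable]: "Z \<in> events" unfolding Z_def by measurable
    have "prob Z \<le> erlang_CDF n 1 (real j)" for n
    proof -
      have "prob Z \<le> prob {\<omega> \<in> space M. ring_time (gap z) (Suc n) \<omega> \<le> real j}"
        by (rule finite_measure_mono) (auto simp: Z_def)
      also have "\<dots> = erlang_CDF n 1 (real j)"
        by (rule erlang_distributed_le[OF ring_time_distributed[OF z]]) auto
      finally show ?thesis .
    qed
    then have "prob Z \<le> 0"
      by (intro LIMSEQ_le_const[OF erlang_CDF_tendsto_0[of "real j"]]) auto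
    then have "prob Z = 0" by (simp add: measure_le_0_iff)
    then have "AE \<omega> in M. \<omega> \<notin> Z"
      by (intro AE_not_in null_setsI) (auto simp: emeasure_eq_measure)
    then show ?thesis by (rule AE_mp) (auto intro!: AE_I2 simp: Z_def not_le)
  qed
  then have "AE \<omega> in M. \<forall>j :: nat. \<exists>n. real j < ring_time (gap z) n \<omega>" by (simp add: AE_all_countable)
  then show ?thesis
  proof (rule AE_mp, intro AE_I2 impI allI)
    fix \<omega> and \<tau> :: real
    assume u: "\<forall>j :: nat. \<exists>n. real j < ring_time (gap z) n \<omega>" and tau: "0 \<le> \<tau>"
    obtain j :: nat where "\<tau> \<le> real j" using real_arch_simple by blast
    with u have ex: "\<exists>n. \<tau> < ring_time (gap z) n \<omega>" by (meson le_less_trans)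
    define N where "N = (LEAST n. \<tau> < ring_time (gap z) n \<omega>)"
    have N: "\<tau> < ring_time (gap z) N \<omega>" unfolding N_def by (rule LeastI_ex[OF ex])
    then obtain n where n: "N = Suc n" using tau by (cases N) (auto simp: ring_time_def)
    have "\<not> \<tau> < ring_time (gap z) n \<omega>"
      by (rule not_less_Least) (use n in \<open>simp add: N_def[symmetric]\<close>)
    then show "\<exists>n. ring_time (gap z) n \<omega> \<le> \<tau> \<and> \<tau> < ring_time (gap z) (Suc n) \<omega>"
      using N n by (auto simp: not_less)
  qed
qed

text \<open>The arrow at \<open>z\<close> equals \<open>sg\<close> at some dynamical time in \<open>[a, b)\<close>, expressed through the waiting times and
marks, from which measurability and independence can be read off: the mark in force at time \<open>a\<close>, or
one of those drawn later and before \<open>b\<close>, is \<open>sg\<close>.\<close>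

definition attains :: "int \<Rightarrow> real \<Rightarrow> real \<Rightarrow> int \<times> int \<Rightarrow> 'a \<Rightarrow> bool" where
  "attains sg a b z \<omega> \<longleftrightarrow> (\<exists>n. mark z n \<omega> = sg \<and>
     (ring_time (gap z) n \<omega> \<le> a \<and> a < ring_time (gap z) (Suc n) \<omega> \<or>
      a < ring_time (gap z) n \<omega> \<and> ring_time (gap z) n \<omega> < b))"

lemma attains_mono:
  assumes "attains sg a' b' z \<omega>" "a \<le> a'" "a' < b'" "b' \<le> b"
  shows "attains sg a b z \<omega>"
proof -
  obtain n where n: "mark z n \<omega> = sg"
     "ring_time (gap z) n \<omega> \<le> a' \<and> a' < ring_time (gap z) (Suc n) \<omega> \<or>
      a' < ring_time (gap z) n \<omega> \<and> ring_time (gap z) n \<omega> < b'"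
    using assms(1) by (auto simp: attains_def)
  then show ?thesis unfolding attains_def
    using assms(2-) by (intro exI[of _ n]) linarith
qed

lemma mark_prob:
  assumes "z \<in> even_lattice" "sg \<in> {-1, 1}"
  shows "prob {\<omega> \<in> space M. mark z n \<omega> = sg} = 1/2"
proof -
  have "measure (distr M (count_space UNIV) (mark z n)) {sg} = prob {\<omega> \<in> space M. mark z n \<omega> = sg}"
    by (subst measure_distr) (use mark_uniform(1)[OF assms(1)] in \<open>auto intro!: arg_cong[where f = prob]\<close>)
  also have "measure (distr M (count_space UNIV) (mark z n)) {sg} = 1/2"
    unfolding mark_uniform(2)[OF assms(1)] using assms(2)
    by (auto simp: measure_pmf_single)
  finally show ?thesis by simp
qed

text \<open>The value in force at time \<open>a\<close> is a fair coin, as marks are independent of ring times; the clock rings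
inside the interval with probability at most its length. The events that the \<open>n\<close>-th mark is in force
at time \<open>a\<close> are disjoint only almost surely, as waiting times are almost surely positive, whence the
telescoping sum.\<close>

lemma attains_prob_le:
  assumes z: "z \<in> even_lattice" and sg: "sg \<in> {-1, 1}" and ab: "0 \<le> a" "a \<le> b"
  shows "prob {\<omega> \<in> space M. attains sg a b z \<omega>} \<le> 1/2 + (b - a)"
proof -
  let ?T = "\<lambda>n. ring_time (gap z) n"
  have [measurable]: "?T n \<in> borel_measurable M" "mark z n \<in> measurable M (count_space UNIV)" for n
    by (rule ring_time_M[OF z], rule mark_uniform(1)[OF z])
  define before where "before n = {\<omega> \<in> space M. ?T n \<omega> \<le> a}" for n
  define curr where "curr n = {\<omega> \<in> space M. ?T n \<omega> \<le> a \<and> a < ?T (Suc n) \<omega>}" for n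
  define inside where "inside n = {\<omega> \<in> space M. a < ?T n \<omega> \<and> ?T n \<omega> < b}" for n
  define hit where "hit n = {\<omega> \<in> space M. mark z n \<omega> = sg}" for n
  have [measurable]: "before n \<in> events" "curr n \<in> events" "inside n \<in> events" "hit n \<in> events" for n
    unfolding before_def curr_def inside_def hit_def by measurable
  define A where "A n = (hit n \<inter> curr n) \<union> inside n" for n
  have "prob (hit n \<inter> curr n) = prob (hit n) * prob (curr n)" for n
  proof (rule generated_indep)
    let ?K = "{Inr (z, n)} :: ((int \<times> int) \<times> nat + (int \<times> int) \<times> nat) set"
    let ?L = "range (\<lambda>n. Inl (z, n)) :: ((int \<times> int) \<times> nat + (int \<times> int) \<times> nat) set"
    show "?K \<subseteq> labels UNIV" "?L \<subseteq> labels UNIV" "?K \<inter> ?L = {}"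
      using z by (auto intro: labels_memI)
    have [measurable]: "mark z n \<in> measurable (generated ?K) (count_space UNIV)"
      by (rule mark_generated) simp
    have "{\<omega> \<in> space (generated ?K). mark z n \<omega> = sg} \<in> sets (generated ?K)" by measurable
    then show "hit n \<in> sets (generated ?K)" by (simp add: hit_def)
    have [measurable]: "?T m \<in> borel_measurable (generated ?L)" for m
      by (rule ring_time_generated) simp
    have "{\<omega> \<in> space (generated ?L). ?T n \<omega> \<le> a \<and> a < ?T (Suc n) \<omega>} \<in> sets (generated ?L)"
      by measurable
    then show "curr n \<in> sets (generated ?L)" by (simp add: curr_def)
  qed
  then have vc: "prob (hit n \<inter> curr n) = prob (curr n) / 2" for n
    using mark_prob[OF z sg] by (simp add: hit_def)
  have telescope: "prob (curr n) \<le> prob (before n) - prob (before (Suc n))" for n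
  proof -
    have "prob {\<omega> \<in> space M. 0 < gap z n \<omega>} = 1"
      using exponential_distributedD_gt[OF gap_exponential[OF z], of 0 n] by simp
    then have "AE \<omega> in M. 0 < gap z n \<omega>" by (subst (asm) prob_Collect_eq_1) (use distributed_measurable[OF gap_exponential[OF z]] in auto)
    then have "AE \<omega> in M. \<omega> \<in> before (Suc n) \<longrightarrow> \<omega> \<in> before n"
      by (rule AE_mp) (auto intro!: AE_I2 simp: before_def ring_time_def)
    then have "prob (before (Suc n)) \<le> prob (before n \<inter> before (Suc n))"
      by (intro finite_measure_mono_AE) auto
    moreover have "prob (curr n) = prob (before n) - prob (before n \<inter> before (Suc n))"
    proof -
      have "curr n = before n - before n \<inter> before (Suc n)"
        by (auto simp: curr_def before_def)
      then show ?thesis by (simp add: finite_measure_Diff)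
    qed
    ultimately show ?thesis by simp
  qed
  have pA: "prob (A n) \<le> (prob (before n) - prob (before (Suc n))) / 2 + prob (inside n)" for n
  proof -
    have "prob (A n) \<le> prob (hit n \<inter> curr n) + prob (inside n)"
      unfolding A_def by (intro measure_Un_le) auto
    also have "\<dots> \<le> (prob (before n) - prob (before (Suc n))) / 2 + prob (inside n)"
      unfolding vc by (intro add_right_mono divide_right_mono telescope) simp
    finally show ?thesis .
  qed
  have "(\<Sum>n<m. prob (inside n)) \<le> b - a" for m
  proof (cases m)
    case (Suc m')
    have "inside 0 = {}" using ab by (auto simp: inside_def ring_time_def)
    moreover have "(\<Sum>n<m'. prob (inside (Suc n))) \<le> b - a"
      unfolding inside_def by (rule expected_rings_le[OF z ab(2)])
    ultimately show ?thesis unfolding Suc sum.lessThan_Suc_shift by simp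
  qed (use ab in simp)
  then have sum: "(\<Sum>n<m. prob (A n)) \<le> 1/2 + (b - a)" for m
  proof -
    have "(\<Sum>n<m. prob (A n)) \<le> (\<Sum>n<m. (prob (before n) - prob (before (Suc n))) / 2 + prob (inside n))"
      by (intro sum_mono pA)
    also have "\<dots> = (\<Sum>n<m. prob (before n) - prob (before (Suc n))) / 2 + (\<Sum>n<m. prob (inside n))"
      by (simp add: sum.distrib flip: sum_divide_distrib)
    also have "(\<Sum>n<m. prob (before n) - prob (before (Suc n))) = prob (before 0) - prob (before m)"
      by (rule sum_lessThan_telescope')
    also have "\<dots> \<le> 1" using prob_le_1[of "before 0"] measure_nonneg[of M "before m"] by linarith
    finally show ?thesis using \<open>(\<Sum>n<m. prob (inside n)) \<le> b - a\<close> by simp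
  qed
  have summable: "summable (\<lambda>n. prob (A n))"
    by (rule summableI_nonneg_bounded[OF _ sum]) simp
  have "prob {\<omega> \<in> space M. attains sg a b z \<omega>} \<le> prob (\<Union>n. A n)"
    by (rule finite_measure_mono) (auto simp: attains_def A_def hit_def curr_def inside_def)
  also have "\<dots> \<le> (\<Sum>n. prob (A n))"
    by (rule finite_measure_subadditive_countably[OF _ summable]) (auto simp: A_def)
  also have "\<dots> \<le> 1/2 + (b - a)"
    by (rule suminf_le_const[OF summable sum])
  finally show ?thesis .
qed

end

section \<open>Domination of the web paths\<close>

text \<open>Only sites of the even lattice carry genuine arrows, so the walk has to be kept on it.\<close>

lemma walk_parity:
  assumes "\<And>z. z \<in> even_lattice \<Longrightarrow> c z \<in> {-1, 1}"
  shows "even (walk c n + int n)"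
proof (induction n)
  case (Suc n)
  then have "(walk c n, int n) \<in> even_lattice" by (simp add: even_lattice_def)
  then show ?case using assms[of "(walk c n, int n)"] Suc by auto
qed simp

lemma walk_step:
  assumes "\<And>z. z \<in> even_lattice \<Longrightarrow> c z \<in> {-1, 1}"
  shows "c (walk c n, int n) \<in> {-1, 1}"
  using assms[of "(walk c n, int n)"] walk_parity[OF assms, where n = n] by (simp add: even_lattice_def)

lemma abs_walk_le:
  assumes "\<And>z. z \<in> even_lattice \<Longrightarrow> c z \<in> {-1, 1}"
  shows "\<bar>walk c n\<bar> \<le> int n"
proof (induction n)
  case (Suc n)
  then show ?case using walk_step[of c n, OF assms] by auto
qed simp

lemma recurrent_web_path_iff: "recurrent_path (web_path c) \<longleftrightarrow> infinite {n. walk c n = 0}"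
  by (simp add: recurrent_path_def web_path_def frac_def)

lemma walk_one_sided:
  assumes c: "\<And>z. z \<in> even_lattice \<Longrightarrow> c z \<in> {-1, 1}"
    and nz: "\<And>n. n0 \<le> n \<Longrightarrow> walk c n \<noteq> 0"
    and sg: "0 < sg * walk c n0" "sg \<in> {-1, 1}" and n: "n0 \<le> n"
  shows "0 < sg * walk c n"
  using n
proof (induction n rule: dec_induct)
  case (step n)
  then show ?case using walk_step[of c n, OF c] nz[of "Suc n"] sg(2) by auto
qed (rule sg(1))

context dynamical_discrete_web
begin

text \<open>Reflecting space by \<open>sg = -1\<close> turns paths that stay negative into paths that stay positive, so both
cases are handled by one family of arrows.\<close>

definition reflect :: "int \<Rightarrow> int \<times> int \<Rightarrow> int \<times> int" where
  "reflect sg z = (sg * fst z, snd z)"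

text \<open>The largest reflected arrow during the \<open>i\<close>-th interval of generation \<open>k\<close>. Sites off the even lattice carry
no clock; a constant downward arrow there is independent of everything and has no upward bias.\<close>

definition upper_arrow :: "int \<Rightarrow> nat \<Rightarrow> nat \<Rightarrow> int \<times> int \<Rightarrow> 'a \<Rightarrow> int" where
  "upper_arrow sg k i z \<omega> = (if z \<in> even_lattice \<and>
     attains sg (real i / 2^k) ((real i + 1) / 2^k) (reflect sg z) \<omega> then 1 else -1)"

lemma reflect_even_lattice: "sg \<in> {-1, 1} \<Longrightarrow> reflect sg z \<in> even_lattice \<longleftrightarrow> z \<in> even_lattice"
  by (cases z) (auto simp: even_lattice_def reflect_def)

lemma snd_reflect [simp]: "snd (reflect sg z) = snd z"
  by (simp add: reflect_def)

lemma upper_arrow_generated: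
  assumes sg: "sg \<in> {-1, 1}" and Z: "snd -` {snd z} \<subseteq> Z"
  shows "upper_arrow sg k i z \<in> measurable (generated (labels Z)) (count_space UNIV)"
proof (cases "z \<in> even_lattice")
  case True
  then have r: "reflect sg z \<in> even_lattice" "reflect sg z \<in> Z"
    using Z by (auto simp: reflect_even_lattice[OF sg])
  have [measurable]: "mark (reflect sg z) n \<in> measurable (generated (labels Z)) (count_space UNIV)" for n
    by (rule mark_generated) (rule labels_memI[OF r])
  have [measurable]: "ring_time (gap (reflect sg z)) n \<in> borel_measurable (generated (labels Z))" for n
    by (rule ring_time_generated) (rule labels_memI[OF r])
  show ?thesis unfolding upper_arrow_def[abs_def] attains_def by measurable
next
  case False
  then have "upper_arrow sg k i z = (\<lambda>_. -1)" by (simp add: upper_arrow_def fun_eq_iff)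
  then show ?thesis by simp
qed

lemma refining_upper_arrows:
  assumes sg: "sg \<in> {-1, 1}"
  shows "refining_arrows M (\<lambda>t. generated (labels {z. snd z < t}))
    (\<lambda>t. generated (labels {z. t \<le> snd z})) (upper_arrow sg)"
proof (unfold_locales, goal_cases)
  case (2 t)
  show ?case by (rule sets_generated_subset[OF labels_mono])
next
  case (4 t)
  show ?case by (rule sets_generated_subset[OF labels_mono])
next
  case (5 A t B)
  then show ?case
    by (intro generated_indep[OF labels_mono labels_mono]) (auto simp: labels_def)
next
  case (6 z t k i)
  then show ?case by (intro upper_arrow_generated sg) auto
next
  case (7 t z k i)
  then show ?case by (intro upper_arrow_generated sg) auto
next
  case (9 k i z)
  show ?case
  proof (cases "z \<in> even_lattice")
    case True
    then have "prob {\<omega> \<in> space M. attains sg (real i / 2^k) ((real i + 1) / 2^k) (reflect sg z) \<omega>}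
       \<le> 1/2 + ((real i + 1) / 2^k - real i / 2^k)"
      by (intro attains_prob_le sg) (auto simp: reflect_even_lattice[OF sg] divide_right_mono)
    also have "{\<omega> \<in> space M. attains sg (real i / 2^k) ((real i + 1) / 2^k) (reflect sg z) \<omega>}
        = {\<omega> \<in> space M. upper_arrow sg k i z \<omega> = 1}"
      using True by (auto simp: upper_arrow_def)
    finally show ?thesis by (simp add: add_divide_distrib)
  qed (simp add: upper_arrow_def)
next
  case (10 k i z \<omega>)
  have "real (i div 2) \<le> real i / 2" "(real i + 1) / 2 \<le> real (i div 2) + 1"
    using of_nat_mono[of "2 * (i div 2)" i, where 'a = real]
      of_nat_mono[of "i + 1" "2 * (i div 2) + 2", where 'a = real] by auto
  from this[THEN divide_right_mono, of "2^k"]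
  have "real (i div 2) / 2^k \<le> real i / 2^Suc k"
    "(real i + 1) / 2^Suc k \<le> (real (i div 2) + 1) / 2^k"
    by (simp_all add: mult.commute)
  moreover have "real i / 2^Suc k < (real i + 1) / 2^Suc k" by (simp add: divide_strict_right_mono)
  ultimately have "attains sg (real (i div 2) / 2^k) ((real (i div 2) + 1) / 2^k) (reflect sg z) \<omega>"
    if "attains sg (real i / 2^Suc k) ((real i + 1) / 2^Suc k) (reflect sg z) \<omega>"
    using that by (intro attains_mono[OF that])
  then show ?case by (auto simp: upper_arrow_def)
qed (auto simp: upper_arrow_def)

text \<open>The walk is started at time \<open>n0\<close> from height \<open>n0\<close>, the highest point that a path from the origin can
have reached by then.\<close>

lemma survivors_null:
  assumes sg: "sg \<in> {-1, 1}" and n0: "0 < n0"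
  shows "AE \<omega> in M. \<exists>k. \<forall>i<H * 2^k.
    absorbed (\<lambda>z. upper_arrow sg k i z \<omega>) (int n0) (int n0) (4^k) \<le> 0"
proof -
  interpret A: refining_arrows M "\<lambda>t. generated (labels {z. snd z < t})"
    "\<lambda>t. generated (labels {z. t \<le> snd z})" "upper_arrow sg"
    by (rule refining_upper_arrows[OF sg])
  define B where "B k = (\<Union>i<H * 2^k. A.alive k i (int n0) (int n0) (4^k))" for k
  have B [measurable]: "B k \<in> events" for k unfolding B_def by auto
  have lim: "(\<lambda>k. prob (B k)) \<longlonglongrightarrow> 0"
    unfolding B_def by (rule A.some_survivor_prob_tendsto_0) (use n0 in auto)
  have "prob (\<Inter>k. B k) \<le> 0"
    by (rule LIMSEQ_le_const[OF lim]) (auto intro!: finite_measure_mono)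
  then have "prob (\<Inter>k. B k) = 0" by (simp add: measure_le_0_iff)
  then have "AE \<omega> in M. \<omega> \<notin> (\<Inter>k. B k)"
    by (intro AE_not_in null_setsI) (auto simp: emeasure_eq_measure)
  then show ?thesis
  proof (rule AE_mp, intro AE_I2 impI)
    fix \<omega> assume "\<omega> \<in> space M" "\<omega> \<notin> (\<Inter>k. B k)"
    then show "\<exists>k. \<forall>i<H * 2^k.
      absorbed (\<lambda>z. upper_arrow sg k i z \<omega>) (int n0) (int n0) (4^k) \<le> 0"
      by (auto simp: B_def A.alive_def A.pos_def not_less)
  qed
qed

lemma attains_if_value:
  assumes "ring_time (gap z) n \<omega> \<le> \<tau>" "\<tau> < ring_time (gap z) (Suc n) \<omega>" "mark z n \<omega> = sg"
    and "a \<le> \<tau>" "\<tau> < b"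
  shows "attains sg a b z \<omega>"
  unfolding attains_def using assms by (intro exI[of _ n]) linarith

text \<open>If a path is not recurrent at the dynamical time \<open>\<tau>\<close>, it keeps one sign \<open>sg\<close> from some time \<open>n0\<close> on. Its
reflection by \<open>sg\<close> is then never absorbed, and for every \<open>k\<close> it lies below the walk of the interval of
generation \<open>k\<close> that contains \<open>\<tau>\<close>; so some walk of each generation \<open>k\<close> survives until \<open>4^k\<close>.\<close>

theorem AE_recurrent: "AE \<omega> in M. \<forall>\<tau>\<ge>0. recurrent_path (web_path (\<lambda>z. \<xi> z \<tau> \<omega>))"
proof -
  have G1: "AE \<omega> in M. \<forall>z\<in>even_lattice. \<forall>n \<tau>. ring_time (gap z) n \<omega> \<le> \<tau> \<and> \<tau> < ring_time (gap z) (Suc n) \<omega>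
          \<longrightarrow> \<xi> z \<tau> \<omega> = mark z n \<omega>"
    using resampling by (subst AE_ball_countable) auto
  have G2: "AE \<omega> in M. \<forall>z\<in>even_lattice. \<forall>\<tau>\<ge>0. \<exists>n. ring_time (gap z) n \<omega> \<le> \<tau> \<and> \<tau> < ring_time (gap z) (Suc n) \<omega>"
    using ring_times_unbounded by (subst AE_ball_countable) auto
  have G3: "AE \<omega> in M. \<forall>sg\<in>{-1, 1}. \<forall>n0\<in>{0<..}. \<forall>H. \<exists>k. \<forall>i<H * 2^k.
    absorbed (\<lambda>z. upper_arrow sg k i z \<omega>) (int n0) (int n0) (4^k) \<le> 0"
    using survivors_null by (subst AE_ball_countable, simp, subst AE_ball_countable, simp)
      (auto simp: AE_all_countable)
  from G1 G2 G3 AE_space show ?thesis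
  proof eventually_elim
    case (elim \<omega>)
    show ?case
    proof (intro allI impI, rule ccontr)
      fix \<tau> :: real
      assume tau: "0 \<le> \<tau>" and "\<not> recurrent_path (web_path (\<lambda>z. \<xi> z \<tau> \<omega>))"
      define c where "c z = \<xi> z \<tau> \<omega>" for z
      have c: "c z \<in> {-1, 1}" if "z \<in> even_lattice" for z
        using sign_valued[OF that tau] elim(4) by (simp add: c_def)
      have "finite {n. walk c n = 0}"
        using \<open>\<not> recurrent_path _\<close> by (simp add: recurrent_web_path_iff c_def[abs_def])
      then obtain n0 where "\<forall>n\<in>{n. walk c n = 0}. n < n0"
        using finite_nat_set_iff_bounded by blast
      then have nz: "walk c n \<noteq> 0" if "n0 \<le> n" for n using that by auto
      then have n0: "0 < n0" by (metis le0 neq0_conv walk.simps(1) order_refl)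
      define sg where "sg = sgn (walk c n0)"
      have sg: "sg \<in> {-1, 1}" "0 < sg * walk c n0"
        using nz[of n0] by (auto simp: sg_def sgn_if)
      have sg2: "sg * (sg * y) = y" for y using sg(1) by auto
      have pos: "0 < sg * walk c n" if "n0 \<le> n" for n
        by (rule walk_one_sided[OF c nz sg(2,1) that])
      \<comment> \<open>The reflected arrows at the dynamical time \<open>\<tau>\<close>.\<close>
      define d where "d z = (if z \<in> even_lattice then sg * c (reflect sg z) else -1)" for z
      have d: "d z \<in> {-1, 1}" for z
        using c[of "reflect sg z"] sg(1) by (auto simp: d_def reflect_even_lattice[OF sg(1)])
      have follow: "absorbed d (int n0) (sg * walk c n0) n = sg * walk c (n0 + n)" for n
      proof (induction n)
        case (Suc n)
        have "(walk c (n0 + n), int (n0 + n)) \<in> even_lattice"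
          using walk_parity[of c "n0 + n", OF c] by (simp add: even_lattice_def)
        then have "(sg * walk c (n0 + n), int n0 + int n) \<in> even_lattice"
          using reflect_even_lattice[OF sg(1), of "(walk c (n0 + n), int (n0 + n))"]
          by (simp add: reflect_def)
        then show ?case using Suc pos[of "n0 + n"]
          by (simp add: d_def reflect_def sg2 algebra_simps)
      qed simp
      obtain H :: nat where H: "\<tau> < real H" using reals_Archimedean2 by blast
      obtain k where k: "\<And>i. i < H * 2^k \<Longrightarrow>
          absorbed (\<lambda>z. upper_arrow sg k i z \<omega>) (int n0) (int n0) (4^k) \<le> 0"
        using elim(3) sg(1) n0 by (meson greaterThan_iff)
      define i where "i = nat \<lfloor>\<tau> * 2^k\<rfloor>"
      have i: "real i \<le> \<tau> * 2^k" "\<tau> * 2^k < real i + 1"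
        using tau by (auto simp: i_def)
      have "\<tau> * 2^k < real H * 2^k" using H by simp
      then have "real i < real (H * 2^k)"
        unfolding of_nat_mult of_nat_power of_nat_numeral using i(1) by linarith
      then have iH: "i < H * 2^k" by (simp only: of_nat_less_iff)
      have ab: "real i / 2^k \<le> \<tau>" "\<tau> < (real i + 1) / 2^k"
        using i by (auto simp: field_simps)
      have "d z \<le> upper_arrow sg k i z \<omega>" for z
      proof (cases "z \<in> even_lattice \<and> d z = 1")
        case True
        then have r: "reflect sg z \<in> even_lattice" by (simp add: reflect_even_lattice[OF sg(1)])
        obtain n where n: "ring_time (gap (reflect sg z)) n \<omega> \<le> \<tau>"
            "\<tau> < ring_time (gap (reflect sg z)) (Suc n) \<omega>"
          using elim(2) r tau by blast
        then have "mark (reflect sg z) n \<omega> = c (reflect sg z)"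
          using elim(1) r by (simp add: c_def)
        also have "\<dots> = sg" using True sg(1) by (auto simp: d_def)
        finally have "attains sg (real i / 2^k) ((real i + 1) / 2^k) (reflect sg z) \<omega>"
          by (rule attains_if_value[OF n _ ab])
        then show ?thesis using True by (simp add: upper_arrow_def)
      next
        case False
        then have "d z = -1" using d[of z] by (auto simp: d_def)
        then show ?thesis by (simp add: upper_arrow_def)
      qed
      then have "absorbed d (int n0) (sg * walk c n0) (4^k)
          \<le> absorbed (\<lambda>z. upper_arrow sg k i z \<omega>) (int n0) (int n0) (4^k)"
      proof (intro absorbed_mono d)
        show "upper_arrow sg k i z \<omega> \<in> {-1, 1}" for z by (simp add: upper_arrow_def)
        show "0 \<le> sg * walk c n0" using sg by simp
        show "sg * walk c n0 \<le> int n0" using abs_walk_le[of c n0, OF c] sg(1) by auto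
        show "even (sg * walk c n0 + int n0)" using walk_parity[of c n0, OF c] sg(1) by auto
        show "even (int n0 + int n0)" by simp
      qed
      also have "\<dots> \<le> 0" by (rule k[OF iH])
      finally show False using pos[of "n0 + 4^k"] by (simp add: follow)
    qed
  qed
qed

end

theorem theorem2p1:
  fixes M :: "'a measure"
    and gap :: "int \<times> int \<Rightarrow> nat \<Rightarrow> 'a \<Rightarrow> real"
    and mark :: "int \<times> int \<Rightarrow> nat \<Rightarrow> 'a \<Rightarrow> int"
    and \<xi> :: "int \<times> int \<Rightarrow> real \<Rightarrow> 'a \<Rightarrow> int"
  assumes "dynamical_discrete_web M gap mark \<xi>"
  shows "AE \<omega> in M. \<forall>\<tau>\<ge>0. recurrent_path (web_path (\<lambda>z. \<xi> z \<tau> \<omega>))"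
  by (rule dynamical_discrete_web.AE_recurrent[OF assms])

end
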